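(* Let $d\ge 2$. (a) Let $p \in \mathbb{C}[z_1,\dots,z_{d-1},w]$ be non-vanishing in $U_d$ near $0$ (i.e. $p$ has no zeros in $U_d\cap B(0,\epsilon)$ for some $\epsilon>0$), with $p(0)=0$ and $\nabla p(0)\neq 0$. Let $Hp(0)=\left(\frac{\partial^2 p}{\partial z_j\partial z_k}(0)\right)_{j,k=1,\dots,d-1}$ be the Hessian matrix of $p$ with respect to $z=(z_1,\dots,z_{d-1})$ at $0$. Then $\nabla p(0)$ is a multiple of $\vec e_d$ and the matrix $$\frac{1}{2|\nabla p(0)|}Hp(0)$$ is contractive. (b) Partial converse: if $p\in\mathbb{C}[z_1,\dots,z_{d-1},w]$ is a polynomial such that $p(0)=0$, $\nabla p(0)$ is a nonzero multiple of $\vec e_d$, and $\frac{1}{2|\nabla p(0)|}Hp(0)$ is strictly contractive, then $p$ is non-vanishing near $0$ within $U_d$ (i.e. there is $\epsilon>0$ such that $p$ has no zeros in $U_d\cap B(0,\epsilon)$). Furthermore, in this case, for any function $q$ analytic near $0\in\mathbb{C}^d$, the quotient $q/p$ is bounded near $0$ within $U_d$ if and only if $q\in (w,(z)^2)$.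
   Context: $U_d=\{(z_1,\dots,z_{d-1},w)\in\mathbb{C}^d:\ \Im w>\sum_{j=1}^{d-1}|z_j|^2\}$ is the Siegel half-space. $B(0,\epsilon)$ is the Euclidean ball of radius $\epsilon$ in $\mathbb{C}^d$. $\nabla p(0)$ is the vector of complex partial derivatives $(\partial p/\partial z_1,\dots,\partial p/\partial z_{d-1},\partial p/\partial w)$ at $0$, and $|\nabla p(0)|$ is its Euclidean norm; $\vec e_d=(0,\dots,0,1)$ is the $w$-direction. A matrix is contractive (strictly contractive) if its operator norm with respect to the Euclidean norm is $\le 1$ ($<1$). $(z)^2$ denotes the ideal generated by the monomials $z^\alpha=z_1^{\alpha_1}\cdots z_{d-1}^{\alpha_{d-1}}$ with $|\alpha|=2$, and $(w,(z)^2)$ is the ideal generated by $w$ and $(z)^2$ in the ring $\mathbb{C}\{z_1,\dots,z_{d-1},w\}$ of convergent power series centered at $0$. "$q/p$ is bounded near $0$ within $U_d$" means that $q/p$ is bounded on $U_d\cap B(0,\epsilon)$ for some $\epsilon>0$. *)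

theory Defs
  imports "HOL-Analysis.Analysis" "HOL-Library.Poly_Mapping"
begin

text \<open>
  Complex \<open>d\<close>-space with coordinates \<open>(z\<^sub>1, \<dots>, z\<^sub>d\<^sub>-\<^sub>1, w)\<close> is the type \<open>complex ^ ('n option)\<close>,
  where \<open>CARD('n) = d - 1 \<ge> 1\<close>: the index \<open>Some j\<close> stands for \<open>z\<^sub>j\<close> and \<open>None\<close> for \<open>w\<close>.
  Its norm is the Euclidean one, so \<open>ball 0 \<epsilon>\<close> is the Euclidean ball.
\<close>

definition siegel :: "(complex ^ ('n::finite option)) set" where
  "siegel = {\<zeta>. Im (\<zeta> $ None) > (\<Sum>j\<in>UNIV. (cmod (\<zeta> $ Some j))\<^sup>2)}"

definition monomial_at :: "('v::finite \<Rightarrow>\<^sub>0 nat) \<Rightarrow> complex ^ 'v \<Rightarrow> complex" where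
  "monomial_at \<alpha> \<zeta> = (\<Prod>i\<in>UNIV. (\<zeta> $ i) ^ Poly_Mapping.lookup \<alpha> i)"

text \<open>
  Polynomials in variables indexed by \<open>'v\<close> are the elements of the monoid ring
  \<open>('v \<Rightarrow>\<^sub>0 nat) \<Rightarrow>\<^sub>0 complex\<close>.
\<close>

definition poly_at :: "(('v::finite \<Rightarrow>\<^sub>0 nat) \<Rightarrow>\<^sub>0 complex) \<Rightarrow> complex ^ 'v \<Rightarrow> complex" where
  "poly_at p \<zeta> = (\<Sum>\<alpha>\<in>Poly_Mapping.keys p. Poly_Mapping.lookup p \<alpha> * monomial_at \<alpha> \<zeta>)"

definition partial_deriv ::
  "'v::finite \<Rightarrow> (complex ^ 'v \<Rightarrow> complex) \<Rightarrow> complex ^ 'v \<Rightarrow> complex" where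
  "partial_deriv i f \<zeta> = deriv (\<lambda>t. f (\<zeta> + axis i t)) 0"

definition gradient0 :: "(complex ^ 'v::finite \<Rightarrow> complex) \<Rightarrow> complex ^ 'v" where
  "gradient0 f = (\<chi> i. partial_deriv i f 0)"

definition hessian0 :: "(complex ^ ('n::finite option) \<Rightarrow> complex) \<Rightarrow> complex ^ 'n ^ 'n" where
  "hessian0 f = (\<chi> j k. partial_deriv (Some j) (partial_deriv (Some k) f) 0)"

definition contractive :: "complex ^ 'n::finite ^ 'n \<Rightarrow> bool" where
  "contractive A \<longleftrightarrow> onorm (\<lambda>v. A *v v) \<le> 1"

definition strictly_contractive :: "complex ^ 'n::finite ^ 'n \<Rightarrow> bool" where
  "strictly_contractive A \<longleftrightarrow> onorm (\<lambda>v. A *v v) < 1"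

definition nonvanishing_near0 :: "(complex ^ ('n::finite option) \<Rightarrow> complex) \<Rightarrow> bool" where
  "nonvanishing_near0 f \<longleftrightarrow> (\<exists>\<epsilon>>0. \<forall>\<zeta> \<in> siegel \<inter> ball 0 \<epsilon>. f \<zeta> \<noteq> 0)"

definition bounded_near0 :: "(complex ^ ('n::finite option) \<Rightarrow> complex) \<Rightarrow> bool" where
  "bounded_near0 f \<longleftrightarrow> (\<exists>\<epsilon>>0. bounded (f ` (siegel \<inter> ball 0 \<epsilon>)))"

text \<open>
  The ring of convergent power series is represented by the functions that equal the sum of a
  power series on a neighbourhood of \<open>0\<close>, two such functions being identified when they agree
  near \<open>0\<close>. Elsewhere their values are arbitrary.
\<close>

definition analytic_near0 :: "(complex ^ 'v::finite \<Rightarrow> complex) \<Rightarrow> bool" where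
  "analytic_near0 f \<longleftrightarrow>
     (\<exists>c :: ('v \<Rightarrow>\<^sub>0 nat) \<Rightarrow> complex. \<exists>r>0. \<forall>\<zeta> \<in> ball 0 r.
        ((\<lambda>\<alpha>. c \<alpha> * monomial_at \<alpha> \<zeta>) has_sum f \<zeta>) UNIV)"

text \<open>
  The ideal generated by \<open>S\<close>: all finite combinations of elements of \<open>S\<close> with coefficients in
  that ring, with equality understood near \<open>0\<close>.
\<close>

definition generated_ideal ::
  "(complex ^ 'v::finite \<Rightarrow> complex) set \<Rightarrow> (complex ^ 'v \<Rightarrow> complex) set" where
  "generated_ideal S =
     {f. \<exists>T a. finite T \<and> T \<subseteq> S \<and> (\<forall>g\<in>T. analytic_near0 (a g)) \<and>
           (\<forall>\<^sub>F \<zeta> in nhds 0. f \<zeta> = (\<Sum>g\<in>T. a g \<zeta> * g \<zeta>))}"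

definition z_squared_ideal :: "(complex ^ ('n::finite option) \<Rightarrow> complex) set" where
  "z_squared_ideal =
     generated_ideal {\<lambda>\<zeta>. \<Prod>j\<in>UNIV. (\<zeta> $ Some j) ^ \<alpha> j | \<alpha> :: 'n \<Rightarrow> nat. (\<Sum>j\<in>UNIV. \<alpha> j) = 2}"

definition w_z_squared_ideal :: "(complex ^ ('n::finite option) \<Rightarrow> complex) set" where
  "w_z_squared_ideal = generated_ideal (insert (\<lambda>\<zeta>. \<zeta> $ None) z_squared_ideal)"

end

theory Submission
  imports Defs "HOL-Complex_Analysis.Great_Picard" "HOL-Library.Landau_Symbols" "HOL-Real_Asymp.Real_Asymp"
begin

text \<open>
  The variable \<open>w\<close> has weight 2 and each \<open>z\<^sub>j\<close> weight 1, since \<open>|z|\<^sup>2 < |w|\<close> on \<open>U\<^sub>d\<close>. If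
  \<open>p(0) = 0\<close>, then up to weight 2 the polynomial \<open>p\<close> is the sum of its linear part and
  \<open>(1/2) z\<^sup>T H z\<close>, where \<open>H = Hp(0)\<close>.

  For (a), restrict \<open>p\<close> to the discs \<open>s \<mapsto> (t s u, i t\<^sup>2)\<close> in \<open>U\<^sub>d\<close>, where \<open>|u| \<le> 1\<close> and \<open>|s| < 1\<close>, and
  let \<open>t \<rightarrow> 0\<close>. After division by \<open>t\<close> the limit is \<open>s\<close> times the \<open>z\<close>-gradient applied to \<open>u\<close>; it
  vanishes at \<open>s = 0\<close>, so by Hurwitz it is identically 0. After division by \<open>t\<^sup>2\<close> the limit is then
  \<open>i c + (1/2) s\<^sup>2 u\<^sup>T H u\<close> with \<open>c = \<partial>p/\<partial>w(0) \<noteq> 0\<close>, and Hurwitz forces \<open>|u\<^sup>T H u| \<le> 2|c|\<close>. As \<open>H\<close> is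
  symmetric, polarization turns this into a bound on its operator norm.

  For (b), strict contractivity makes \<open>|p|\<close> comparable to \<open>|w|\<close> on \<open>U\<^sub>d\<close> near 0, so \<open>q/p\<close> is bounded
  iff \<open>q = O(w)\<close>. Elements of the ideal are \<open>O(w)\<close>. Conversely, modulo the ideal every analytic \<open>q\<close>
  is an affine function of \<open>z\<close>, and such a function is \<open>O(w)\<close> on \<open>U\<^sub>d\<close> only if it is 0.
\<close>

section \<open>Weighted Taylor expansion of polynomials\<close>

declare One_nat_def [simp del]

lemma monomial_at_0: "monomial_at \<alpha> 0 = (if \<alpha> = 0 then 1 else 0)"
proof (cases "\<alpha> = 0")
  case False
  then obtain i where "Poly_Mapping.lookup \<alpha> i \<noteq> 0"
    by (metis lookup_zero poly_mapping_eqI)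
  then show ?thesis using False
    by (auto simp: monomial_at_def intro!: prod_zero)
qed (simp add: monomial_at_def)

lemma monomial_at_add:
  "monomial_at (\<alpha> + \<beta>) \<zeta> = monomial_at \<alpha> \<zeta> * monomial_at \<beta> \<zeta>"
  by (simp add: monomial_at_def lookup_add power_add prod.distrib)

lemma monomial_at_single: "monomial_at (Poly_Mapping.single i k) \<zeta> = (\<zeta> $ i) ^ k"
proof -
  have "monomial_at (Poly_Mapping.single i k) \<zeta> = (\<Prod>j\<in>UNIV. if j = i then (\<zeta> $ i) ^ k else 1)"
    unfolding monomial_at_def by (rule prod.cong) (auto simp: lookup_single when_def)
  then show ?thesis by simp
qed

lemma single_add_minus:
  assumes "Poly_Mapping.lookup \<alpha> i > 0"
  shows "Poly_Mapping.single i (1::nat) + (\<alpha> - Poly_Mapping.single i 1) = \<alpha>"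
  using assms by (intro poly_mapping_eqI) (auto simp: lookup_add lookup_minus lookup_single when_def)

text \<open>Subtraction of exponents is truncated. If the \<open>i\<close>-th variable does not
  occur in the monomial, the factor \<open>Poly_Mapping.lookup \<alpha> i\<close> is 0, so the usual
  formula covers this case too.\<close>

lemma monomial_has_field_derivative:
  "((\<lambda>t. monomial_at \<alpha> (\<zeta> + axis i t)) has_field_derivative
     of_nat (Poly_Mapping.lookup \<alpha> i) * monomial_at (\<alpha> - Poly_Mapping.single i 1) \<zeta>) (at 0)"
proof -
  define a where "a = Poly_Mapping.lookup \<alpha> i"
  define P where "P = (\<Prod>k\<in>UNIV-{i}. (\<zeta> $ k) ^ Poly_Mapping.lookup \<alpha> k)"
  have 1: "monomial_at \<alpha> (\<zeta> + axis i t) = (\<zeta> $ i + t) ^ a * P" for t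
    unfolding monomial_at_def P_def a_def
    by (subst prod.remove[of _ i]) (auto simp: axis_def intro!: prod.cong)
  have 2: "monomial_at (\<alpha> - Poly_Mapping.single i 1) \<zeta> = (\<zeta> $ i) ^ (a - 1) * P"
    unfolding monomial_at_def P_def a_def
    by (subst prod.remove[of _ i])
       (auto simp: lookup_minus lookup_single when_def intro!: prod.cong)
  show ?thesis
    unfolding 1 2 a_def[symmetric] by (auto intro!: derivative_eq_intros simp: One_nat_def)
qed

text \<open>The exponents are a function \<open>e \<alpha>\<close> of the summation index so that
  the derivative has the same shape as the original sum. A second application, with
  \<open>e \<alpha>\<close> already lowered by one, then gives the Hessian.\<close>

lemma partial_deriv_sum_monomials:
  "partial_deriv i (\<lambda>\<zeta>. \<Sum>\<alpha>\<in>K. c \<alpha> * monomial_at (e \<alpha>) \<zeta>) \<zeta> =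
     (\<Sum>\<alpha>\<in>K. c \<alpha> * of_nat (Poly_Mapping.lookup (e \<alpha>) i) *
        monomial_at (e \<alpha> - Poly_Mapping.single i 1) \<zeta>)"
  unfolding partial_deriv_def
  by (rule DERIV_imp_deriv)
     (auto intro!: derivative_eq_intros monomial_has_field_derivative sum.cong)

lemma gradient0_poly_at:
  "gradient0 (poly_at p) $ i = (\<Sum>\<alpha>\<in>Poly_Mapping.keys p. Poly_Mapping.lookup p \<alpha> *
     (of_nat (Poly_Mapping.lookup \<alpha> i) * monomial_at (\<alpha> - Poly_Mapping.single i 1) 0))"
  using partial_deriv_sum_monomials[of i "Poly_Mapping.lookup p" "\<lambda>\<alpha>. \<alpha>" "Poly_Mapping.keys p" 0]
  by (simp add: gradient0_def poly_at_def[abs_def] mult.assoc)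

lemma hessian0_poly_at:
  "hessian0 (poly_at p) $ j $ k = (\<Sum>\<alpha>\<in>Poly_Mapping.keys p. Poly_Mapping.lookup p \<alpha> *
     (of_nat (Poly_Mapping.lookup \<alpha> (Some k)) *
      of_nat (Poly_Mapping.lookup (\<alpha> - Poly_Mapping.single (Some k) 1) (Some j)) *
      monomial_at (\<alpha> - Poly_Mapping.single (Some k) 1 - Poly_Mapping.single (Some j) 1) 0))"
proof -
  have "partial_deriv (Some k) (poly_at p) = (\<lambda>\<zeta>. \<Sum>\<alpha>\<in>Poly_Mapping.keys p.
      (Poly_Mapping.lookup p \<alpha> * of_nat (Poly_Mapping.lookup \<alpha> (Some k))) *
      monomial_at (\<alpha> - Poly_Mapping.single (Some k) 1) \<zeta>)"
    using partial_deriv_sum_monomials[of "Some k" "Poly_Mapping.lookup p" "\<lambda>\<alpha>. \<alpha>" "Poly_Mapping.keys p"]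
    by (auto simp: poly_at_def[abs_def] fun_eq_iff)
  then show ?thesis
    by (simp only: hessian0_def vec_lambda_beta partial_deriv_sum_monomials) (simp only: mult.assoc)
qed

text \<open>Symmetry holds monomial by monomial: lowering the exponent of one variable leaves that
  of a different variable unchanged, and the two lowerings commute.\<close>

lemma hessian0_poly_at_symmetric:
  "hessian0 (poly_at p) $ j $ k = hessian0 (poly_at p) $ k $ j"
proof -
  have "\<alpha> - Poly_Mapping.single (Some k) 1 - Poly_Mapping.single (Some j) 1 =
        \<alpha> - Poly_Mapping.single (Some j) 1 - Poly_Mapping.single (Some k) (1::nat)"
    for \<alpha> :: "'a option \<Rightarrow>\<^sub>0 nat"
    by (intro poly_mapping_eqI) (auto simp: lookup_minus)
  moreover have "Poly_Mapping.lookup \<alpha> (Some k) * Poly_Mapping.lookup (\<alpha> - Poly_Mapping.single (Some k) 1) (Some j)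
     = Poly_Mapping.lookup \<alpha> (Some j) * Poly_Mapping.lookup (\<alpha> - Poly_Mapping.single (Some j) 1) (Some k)"
    for \<alpha> :: "'a option \<Rightarrow>\<^sub>0 nat"
    by (auto simp: lookup_minus lookup_single when_def)
  ultimately show ?thesis
    unfolding hessian0_poly_at by (simp flip: of_nat_mult)
qed

text \<open>Euler's relation in one variable. The exponent stays as a factor on both sides because
  for exponent 0 the monomials themselves need not match. Summed over \<open>i\<close> it produces
  the degree, which identifies the linear and quadratic Taylor terms of a monomial.\<close>

lemma monomial_euler:
  fixes \<zeta> :: "complex ^ 'v::finite"
  shows "of_nat (Poly_Mapping.lookup \<alpha> i) * monomial_at (\<alpha> - Poly_Mapping.single i 1) \<zeta> * \<zeta> $ i
     = of_nat (Poly_Mapping.lookup \<alpha> i) * monomial_at \<alpha> \<zeta>"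
proof (cases "Poly_Mapping.lookup \<alpha> i > 0")
  case True
  then show ?thesis
    using monomial_at_add[of "Poly_Mapping.single i 1" "\<alpha> - Poly_Mapping.single i 1" \<zeta>]
    by (simp only: single_add_minus monomial_at_single) (simp add: mult_ac)
qed simp

section \<open>Degrees and weights of monomials\<close>

definition total_degree :: "('v::finite \<Rightarrow>\<^sub>0 nat) \<Rightarrow> nat" where
  "total_degree \<alpha> = (\<Sum>i\<in>UNIV. Poly_Mapping.lookup \<alpha> i)"

lemma total_degree_eq_0: "total_degree \<alpha> = 0 \<longleftrightarrow> \<alpha> = 0"
  by (auto simp: total_degree_def intro!: poly_mapping_eqI)

lemma total_degree_add: "total_degree (\<alpha> + \<beta>) = total_degree \<alpha> + total_degree \<beta>"
  by (simp add: total_degree_def lookup_add sum.distrib)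

lemma total_degree_minus_single:
  assumes "Poly_Mapping.lookup \<alpha> i > 0"
  shows "total_degree (\<alpha> - Poly_Mapping.single i 1) = total_degree \<alpha> - 1"
proof -
  have "total_degree (Poly_Mapping.single i 1) = (\<Sum>j\<in>UNIV. if j = i then 1 else 0)"
    unfolding total_degree_def by (rule sum.cong) (auto simp: lookup_single when_def)
  then have 1: "total_degree (Poly_Mapping.single i 1) = 1" by simp
  have "total_degree (Poly_Mapping.single i 1 + (\<alpha> - Poly_Mapping.single i 1)) =
      total_degree (Poly_Mapping.single i 1) + total_degree (\<alpha> - Poly_Mapping.single i 1)"
    by (rule total_degree_add)
  then show ?thesis by (simp add: single_add_minus[OF assms] 1)
qed

text \<open>The left side is a first partial derivative of the monomial at 0. It survives only if
  the differentiated monomial is constant, that is, if the monomial is the \<open>i\<close>-th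
  coordinate itself.\<close>

lemma lookup_mult_monomial_at_0:
  assumes "\<not> (total_degree \<alpha> = 1 \<and> Poly_Mapping.lookup \<alpha> i > 0)"
  shows "of_nat (Poly_Mapping.lookup \<alpha> i) * monomial_at (\<alpha> - Poly_Mapping.single i 1) 0 = 0"
proof (cases "Poly_Mapping.lookup \<alpha> i > 0")
  case True
  have "\<alpha> - Poly_Mapping.single i 1 \<noteq> 0"
  proof
    assume h: "\<alpha> - Poly_Mapping.single i 1 = 0"
    have "\<alpha> = Poly_Mapping.single i 1" using single_add_minus[OF True] h by simp
    then have "total_degree \<alpha> = (\<Sum>j\<in>UNIV. if j = i then 1 else 0)"
      unfolding total_degree_def by (intro sum.cong) (auto simp: lookup_single when_def)
    then show False using assms True by simp
  qed
  then show ?thesis by (simp add: monomial_at_0)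
qed simp

lemma sum_UNIV_option: "(\<Sum>i\<in>UNIV. f i) = f None + (\<Sum>j\<in>UNIV. f (Some j))"
  for f :: "'a::finite option \<Rightarrow> 'b::comm_monoid_add"
  by (simp add: UNIV_option_conv sum.reindex)

lemma prod_UNIV_option: "(\<Prod>i\<in>UNIV. f i) = f None * (\<Prod>j\<in>UNIV. f (Some j))"
  for f :: "'a::finite option \<Rightarrow> 'b::comm_monoid_mult"
  by (simp add: UNIV_option_conv prod.reindex)

text \<open>The exponent of \<open>\<rho>\<close> is the weighted degree: adding
  \<open>Poly_Mapping.lookup \<alpha> None\<close> to the total degree counts \<open>w\<close>
  twice.\<close>

lemma norm_monomial_at_le:
  fixes \<zeta> :: "complex ^ ('n::finite option)"
  assumes "\<And>j. cmod (\<zeta> $ Some j) \<le> \<rho>" "cmod (\<zeta> $ None) \<le> \<rho>\<^sup>2"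
  shows "cmod (monomial_at \<alpha> \<zeta>) \<le> \<rho> ^ (total_degree \<alpha> + Poly_Mapping.lookup \<alpha> None)"
proof -
  have \<rho>: "\<rho> \<ge> 0" using assms(1) norm_ge_zero order_trans by blast
  let ?n = "Poly_Mapping.lookup \<alpha> None" and ?m = "\<Sum>j\<in>UNIV. Poly_Mapping.lookup \<alpha> (Some j)"
  have "cmod (monomial_at \<alpha> \<zeta>) = cmod (\<zeta> $ None) ^ ?n *
      (\<Prod>j\<in>UNIV. cmod (\<zeta> $ Some j) ^ Poly_Mapping.lookup \<alpha> (Some j))"
    by (simp add: monomial_at_def prod_UNIV_option norm_mult norm_power flip: prod_norm)
  also have "\<dots> \<le> (\<rho>\<^sup>2) ^ ?n * (\<Prod>j\<in>UNIV. \<rho> ^ Poly_Mapping.lookup \<alpha> (Some j))"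
    using assms \<rho> by (intro mult_mono prod_mono prod_nonneg power_mono conjI) auto
  also have "\<dots> = \<rho> ^ (2 * ?n + ?m)"
    by (simp add: power_add power_sum flip: power_mult)
  also have "2 * ?n + ?m = total_degree \<alpha> + ?n"
    by (simp add: total_degree_def sum_UNIV_option)
  finally show ?thesis .
qed

text \<open>This is v^T A v without conjugation, hence homogeneous of degree 2 over the complex
  scalars.\<close>

abbreviation quadratic_form :: "complex ^ 'n ^ 'n \<Rightarrow> complex ^ 'n::finite \<Rightarrow> complex" where
  "quadratic_form A v \<equiv> \<Sum>j\<in>UNIV. v $ j * (A *v v) $ j"

abbreviation z_part :: "complex ^ ('n::finite option) \<Rightarrow> complex ^ 'n" where
  "z_part \<zeta> \<equiv> \<chi> j. \<zeta> $ Some j"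

text \<open>Here \<open>g\<close> and \<open>h\<close> are the first and second derivatives of the
  monomial at 0. A monomial of degree at most 1, or of degree 2 in \<open>z\<close> alone, equals
  its own Taylor term, so the remainder is 0. Every other monomial has weight at least 3 and all its
  subtracted terms vanish, so the weight bound applies, with constant 1 because
  \<open>\<rho> \<le> 1\<close>.\<close>

lemma monomial_weighted_taylor:
  fixes \<zeta> :: "complex ^ ('n::finite option)" and \<alpha> :: "'n option \<Rightarrow>\<^sub>0 nat"
  assumes "0 \<le> \<rho>" "\<rho> \<le> 1" "\<And>j. cmod (\<zeta> $ Some j) \<le> \<rho>" "cmod (\<zeta> $ None) \<le> \<rho>\<^sup>2"
  defines "g \<equiv> \<lambda>i. of_nat (Poly_Mapping.lookup \<alpha> i) * monomial_at (\<alpha> - Poly_Mapping.single i 1) 0"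
  defines "h \<equiv> \<lambda>j k. of_nat (Poly_Mapping.lookup \<alpha> (Some k)) *
      of_nat (Poly_Mapping.lookup (\<alpha> - Poly_Mapping.single (Some k) 1) (Some j)) *
      monomial_at (\<alpha> - Poly_Mapping.single (Some k) 1 - Poly_Mapping.single (Some j) 1) 0"
  shows "cmod (monomial_at \<alpha> \<zeta> - monomial_at \<alpha> 0 - (\<Sum>i\<in>UNIV. g i * \<zeta> $ i) -
     (1/2) * (\<Sum>j\<in>UNIV. \<Sum>k\<in>UNIV. h j k * \<zeta> $ Some j * \<zeta> $ Some k)) \<le> \<rho> ^ 3"
proof -
  have g0: "g i = 0" if "total_degree \<alpha> \<noteq> 1" for i
    unfolding g_def using that lookup_mult_monomial_at_0[of \<alpha> i] by simp
  have h0: "h j k = 0" if "total_degree \<alpha> \<noteq> 2" for j k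
  proof (cases "Poly_Mapping.lookup \<alpha> (Some k) > 0")
    case True
    have "total_degree \<alpha> \<noteq> 0" using True by (auto simp: total_degree_eq_0)
    then have "total_degree (\<alpha> - Poly_Mapping.single (Some k) 1) \<noteq> 1"
      using total_degree_minus_single[OF True] that by simp
    then show ?thesis unfolding h_def
      using lookup_mult_monomial_at_0[of "\<alpha> - Poly_Mapping.single (Some k) 1" "Some j"]
      by (simp add: mult.assoc)
  qed (simp add: h_def)
  consider "total_degree \<alpha> = 0" | "total_degree \<alpha> = 1"
    | "total_degree \<alpha> = 2" "Poly_Mapping.lookup \<alpha> None = 0"
    | "total_degree \<alpha> = 2" "Poly_Mapping.lookup \<alpha> None > 0" | "total_degree \<alpha> \<ge> 3"
    by linarith
  then show ?thesis
  proof cases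
    case 1
    then have "\<alpha> = 0" by (simp add: total_degree_eq_0)
    then show ?thesis using 1 g0 h0 assms(1) by (simp add: monomial_at_def)
  next
    case 2
    then have "\<alpha> \<noteq> 0" using total_degree_eq_0[of \<alpha>] by auto
    have "g i * \<zeta> $ i = of_nat (Poly_Mapping.lookup \<alpha> i) * monomial_at \<alpha> \<zeta>" for i
    proof (cases "Poly_Mapping.lookup \<alpha> i > 0")
      case True
      have "\<alpha> - Poly_Mapping.single i 1 = 0"
        using total_degree_minus_single[OF True] 2 by (simp add: total_degree_eq_0)
      then have "g i = of_nat (Poly_Mapping.lookup \<alpha> i) * monomial_at (\<alpha> - Poly_Mapping.single i 1) \<zeta>"
        by (simp add: g_def monomial_at_def)
      then show ?thesis using monomial_euler[of \<alpha> i \<zeta>] by simp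
    qed (simp add: g_def)
    then have "(\<Sum>i\<in>UNIV. g i * \<zeta> $ i) = of_nat (total_degree \<alpha>) * monomial_at \<alpha> \<zeta>"
      by (simp add: total_degree_def sum_distrib_right)
    then show ?thesis using 2 h0 assms(1) \<open>\<alpha> \<noteq> 0\<close> by (simp add: monomial_at_0)
  next
    case 3
    then have "\<alpha> \<noteq> 0" using total_degree_eq_0[of \<alpha>] by auto
    let ?L = "Poly_Mapping.lookup"
    have *: "h j k * \<zeta> $ Some j * \<zeta> $ Some k =
       of_nat (?L \<alpha> (Some k)) * of_nat (?L (\<alpha> - Poly_Mapping.single (Some k) 1) (Some j)) *
       monomial_at \<alpha> \<zeta>" for j k
    proof (cases "?L \<alpha> (Some k) > 0 \<and> ?L (\<alpha> - Poly_Mapping.single (Some k) 1) (Some j) > 0")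
      case True
      define \<beta> where "\<beta> = \<alpha> - Poly_Mapping.single (Some k) 1"
      have "total_degree (\<beta> - Poly_Mapping.single (Some j) 1) = 0"
        using True total_degree_minus_single[of \<alpha> "Some k"] total_degree_minus_single[of \<beta> "Some j"] 3
        by (simp add: \<beta>_def)
      then have "\<beta> - Poly_Mapping.single (Some j) 1 = 0" by (simp add: total_degree_eq_0)
      \<comment> \<open>A monomial with exponent 0 has the value 1 at \<open>\<zeta>\<close> as well
        as at 0. Moving the evaluation point to \<open>\<zeta>\<close> makes Euler's relation
        applicable, once for \<open>j\<close> and once for \<open>k\<close>.\<close>
      then have "h j k = of_nat (?L \<alpha> (Some k)) * (of_nat (?L \<beta> (Some j)) * monomial_at (\<beta> - Poly_Mapping.single (Some j) 1) \<zeta>)"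
        by (simp add: h_def monomial_at_def \<beta>_def[symmetric])
      then have "h j k * \<zeta> $ Some j * \<zeta> $ Some k = of_nat (?L \<alpha> (Some k)) *
         (of_nat (?L \<beta> (Some j)) * monomial_at (\<beta> - Poly_Mapping.single (Some j) 1) \<zeta> * \<zeta> $ Some j) * \<zeta> $ Some k"
        by (simp add: mult_ac)
      also have "\<dots> = of_nat (?L \<beta> (Some j)) * (of_nat (?L \<alpha> (Some k)) * monomial_at \<beta> \<zeta> * \<zeta> $ Some k)"
        unfolding monomial_euler by (simp add: mult_ac)
      also have "\<dots> = of_nat (?L \<beta> (Some j)) * (of_nat (?L \<alpha> (Some k)) * monomial_at \<alpha> \<zeta>)"
        unfolding \<beta>_def monomial_euler ..
      finally show ?thesis by (simp add: \<beta>_def mult_ac)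
    qed (auto simp: h_def)
    \<comment> \<open>Removing one factor from a quadratic monomial in \<open>z\<close> leaves
      degree 1, so the inner sum is 1 wherever its factor is nonzero. The double sum thus counts the
      monomial twice, which cancels the factor 1/2.\<close>
    have **: "?L \<alpha> (Some k) * (\<Sum>j\<in>UNIV. ?L (\<alpha> - Poly_Mapping.single (Some k) 1) (Some j)) = ?L \<alpha> (Some k)" for k
    proof (cases "?L \<alpha> (Some k) > 0")
      case True
      have "(\<Sum>j\<in>UNIV. ?L (\<alpha> - Poly_Mapping.single (Some k) 1) (Some j)) =
          total_degree (\<alpha> - Poly_Mapping.single (Some k) 1)"
        using 3 by (simp add: total_degree_def sum_UNIV_option lookup_minus)
      then show ?thesis using total_degree_minus_single[OF True] 3 by simp
    qed simp
    have "(\<Sum>j\<in>UNIV. \<Sum>k\<in>UNIV. h j k * \<zeta> $ Some j * \<zeta> $ Some k) =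
      (\<Sum>k\<in>UNIV. \<Sum>j\<in>UNIV. of_nat (?L \<alpha> (Some k)) * of_nat (?L (\<alpha> - Poly_Mapping.single (Some k) 1) (Some j)) *
       monomial_at \<alpha> \<zeta>)"
      unfolding * by (rule sum.swap)
    also have "\<dots> = of_nat (\<Sum>k\<in>UNIV. ?L \<alpha> (Some k) * (\<Sum>j\<in>UNIV. ?L (\<alpha> - Poly_Mapping.single (Some k) 1) (Some j))) * monomial_at \<alpha> \<zeta>"
      by (simp add: sum_distrib_left sum_distrib_right)
    also have "\<dots> = 2 * monomial_at \<alpha> \<zeta>"
      using 3 by (simp only: **) (simp add: total_degree_def sum_UNIV_option flip: of_nat_sum)
    finally show ?thesis using 3 g0 assms(1) \<open>\<alpha> \<noteq> 0\<close> by (simp add: monomial_at_0)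
  next
    case 4
    then have "\<alpha> \<noteq> 0" by auto
    have "h j k = 0" for j k
    proof -
      have "Poly_Mapping.lookup (\<alpha> - Poly_Mapping.single (Some k) 1 - Poly_Mapping.single (Some j) 1) None \<noteq> 0"
        using 4 by (simp add: lookup_minus lookup_single)
      then have "\<alpha> - Poly_Mapping.single (Some k) 1 - Poly_Mapping.single (Some j) 1 \<noteq> 0"
        by (metis lookup_zero)
      then show ?thesis by (simp add: h_def monomial_at_0)
    qed
    moreover have "cmod (monomial_at \<alpha> \<zeta>) \<le> \<rho> ^ (total_degree \<alpha> + Poly_Mapping.lookup \<alpha> None)"
      using assms by (intro norm_monomial_at_le)
    moreover have "\<rho> ^ (total_degree \<alpha> + Poly_Mapping.lookup \<alpha> None) \<le> \<rho> ^ 3"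
      using 4 assms by (intro power_decreasing) auto
    ultimately show ?thesis using 4 g0 \<open>\<alpha> \<noteq> 0\<close> by (simp add: monomial_at_0)
  next
    case 5
    then have "\<alpha> \<noteq> 0" using total_degree_eq_0[of \<alpha>] by auto
    have "cmod (monomial_at \<alpha> \<zeta>) \<le> \<rho> ^ (total_degree \<alpha> + Poly_Mapping.lookup \<alpha> None)"
      using assms by (intro norm_monomial_at_le)
    moreover have "\<rho> ^ (total_degree \<alpha> + Poly_Mapping.lookup \<alpha> None) \<le> \<rho> ^ 3"
      using 5 assms by (intro power_decreasing) auto
    ultimately show ?thesis using 5 g0 h0 \<open>\<alpha> \<noteq> 0\<close> by (simp add: monomial_at_0)
  qed
qed

text \<open>The monomial estimates are added up, so \<open>C\<close> is the sum of the moduli of the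
  coefficients. The scale \<open>\<rho>\<close> stays free: it will be \<open>t\<close> on the discs
  and the square root of |w| on the half-space.\<close>

lemma poly_weighted_taylor:
  fixes p :: "('n::finite option \<Rightarrow>\<^sub>0 nat) \<Rightarrow>\<^sub>0 complex"
  obtains C where "C \<ge> 0"
    "\<And>\<zeta> \<rho>. 0 \<le> \<rho> \<Longrightarrow> \<rho> \<le> 1 \<Longrightarrow> (\<And>j. cmod (\<zeta> $ Some j) \<le> \<rho>) \<Longrightarrow> cmod (\<zeta> $ None) \<le> \<rho>\<^sup>2 \<Longrightarrow>
      cmod (poly_at p \<zeta> - poly_at p 0 - (\<Sum>i\<in>UNIV. gradient0 (poly_at p) $ i * \<zeta> $ i) -
        (1/2) * quadratic_form (hessian0 (poly_at p)) (z_part \<zeta>)) \<le> C * \<rho> ^ 3"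
proof
  define C where "C = (\<Sum>\<alpha>\<in>Poly_Mapping.keys p. cmod (Poly_Mapping.lookup p \<alpha>))"
  show "C \<ge> 0" by (simp add: C_def sum_nonneg)
  fix \<zeta> :: "complex ^ ('n option)" and \<rho> :: real
  assume \<rho>: "0 \<le> \<rho>" "\<rho> \<le> 1" "\<And>j. cmod (\<zeta> $ Some j) \<le> \<rho>" "cmod (\<zeta> $ None) \<le> \<rho>\<^sup>2"
  define K where "K = Poly_Mapping.keys p"
  define c where "c = Poly_Mapping.lookup p"
  define g :: "('n option \<Rightarrow>\<^sub>0 nat) \<Rightarrow> _" where "g = (\<lambda>\<alpha> i. of_nat (Poly_Mapping.lookup \<alpha> i) * monomial_at (\<alpha> - Poly_Mapping.single i 1) 0)"
  define h :: "('n option \<Rightarrow>\<^sub>0 nat) \<Rightarrow> _" where "h = (\<lambda>\<alpha> j k. of_nat (Poly_Mapping.lookup \<alpha> (Some k)) *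
      of_nat (Poly_Mapping.lookup (\<alpha> - Poly_Mapping.single (Some k) 1) (Some j)) *
      monomial_at (\<alpha> - Poly_Mapping.single (Some k) 1 - Poly_Mapping.single (Some j) 1) 0)"
  define R where "R = (\<lambda>\<alpha>. monomial_at \<alpha> \<zeta> - monomial_at \<alpha> 0 - (\<Sum>i\<in>UNIV. g \<alpha> i * \<zeta> $ i) -
     (1/2) * (\<Sum>j\<in>UNIV. \<Sum>k\<in>UNIV. h \<alpha> j k * \<zeta> $ Some j * \<zeta> $ Some k))"
  have R: "cmod (R \<alpha>) \<le> \<rho> ^ 3" for \<alpha>
    unfolding R_def g_def h_def by (rule monomial_weighted_taylor) (use \<rho> in auto)
  have "(\<Sum>i\<in>UNIV. gradient0 (poly_at p) $ i * \<zeta> $ i) = (\<Sum>i\<in>UNIV. \<Sum>\<alpha>\<in>K. c \<alpha> * (g \<alpha> i * \<zeta> $ i))"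
    by (simp add: gradient0_poly_at K_def c_def g_def sum_distrib_right mult.assoc)
  also have "\<dots> = (\<Sum>\<alpha>\<in>K. c \<alpha> * (\<Sum>i\<in>UNIV. g \<alpha> i * \<zeta> $ i))"
    by (subst sum.swap) (simp add: sum_distrib_left)
  finally have G: "(\<Sum>i\<in>UNIV. gradient0 (poly_at p) $ i * \<zeta> $ i) = \<dots>" .
  have "quadratic_form (hessian0 (poly_at p)) (z_part \<zeta>) =
      (\<Sum>j\<in>UNIV. \<Sum>k\<in>UNIV. \<Sum>\<alpha>\<in>K. c \<alpha> * (h \<alpha> j k * \<zeta> $ Some j * \<zeta> $ Some k))"
    by (simp add: matrix_vector_mult_def hessian0_poly_at K_def c_def h_def
        sum_distrib_right sum_distrib_left mult_ac)
  also have "\<dots> = (\<Sum>j\<in>UNIV. \<Sum>\<alpha>\<in>K. \<Sum>k\<in>UNIV. c \<alpha> * (h \<alpha> j k * \<zeta> $ Some j * \<zeta> $ Some k))"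
    by (intro sum.cong refl sum.swap)
  also have "\<dots> = (\<Sum>\<alpha>\<in>K. c \<alpha> * (\<Sum>j\<in>UNIV. \<Sum>k\<in>UNIV. h \<alpha> j k * \<zeta> $ Some j * \<zeta> $ Some k))"
    by (subst sum.swap) (simp add: sum_distrib_left)
  finally have H: "quadratic_form (hessian0 (poly_at p)) (z_part \<zeta>) = \<dots>" .
  have "poly_at p \<zeta> - poly_at p 0 - (\<Sum>i\<in>UNIV. gradient0 (poly_at p) $ i * \<zeta> $ i) -
        (1/2) * quadratic_form (hessian0 (poly_at p)) (z_part \<zeta>) = (\<Sum>\<alpha>\<in>K. c \<alpha> * R \<alpha>)"
  proof -
    have "(\<Sum>\<alpha>\<in>K. c \<alpha> * a \<alpha>) - (\<Sum>\<alpha>\<in>K. c \<alpha> * b \<alpha>) - (\<Sum>\<alpha>\<in>K. c \<alpha> * d \<alpha>) -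
        (1/2) * (\<Sum>\<alpha>\<in>K. c \<alpha> * e \<alpha>) = (\<Sum>\<alpha>\<in>K. c \<alpha> * (a \<alpha> - b \<alpha> - d \<alpha> - (1/2) * e \<alpha>))"
      for a b d e
      by (simp add: sum_subtractf right_diff_distrib sum_distrib_left)
    then show ?thesis
      unfolding G H poly_at_def K_def[symmetric] c_def[symmetric] R_def by simp
  qed
  also have "cmod \<dots> \<le> (\<Sum>\<alpha>\<in>K. cmod (c \<alpha>) * \<rho> ^ 3)"
    by (intro sum_norm_le) (simp add: norm_mult mult_left_mono R)
  finally show "cmod (poly_at p \<zeta> - poly_at p 0 - (\<Sum>i\<in>UNIV. gradient0 (poly_at p) $ i * \<zeta> $ i) -
        (1/2) * quadratic_form (hessian0 (poly_at p)) (z_part \<zeta>)) \<le> C * \<rho> ^ 3"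
    by (simp add: C_def K_def c_def sum_distrib_right)
qed

section \<open>Necessity\<close>

lemma quadratic_form_smult: "quadratic_form A (k *s v) = k\<^sup>2 * quadratic_form A v"
  by (simp add: matrix_vector_mult_def sum_distrib_left power2_eq_square mult_ac)

lemma scaleR_matrix_vector_mult: "(r *\<^sub>R A) *v v = r *\<^sub>R (A *v v)"
  for A :: "complex ^ 'n::finite ^ 'm"
  by (simp add: vec_eq_iff matrix_vector_mult_def scaleR_sum_right)

lemma norm_vec_square: "(norm v)\<^sup>2 = (\<Sum>i\<in>UNIV. (norm (v $ i))\<^sup>2)"
  for v :: "'a::real_normed_vector ^ 'n::finite"
  by (simp add: norm_vec_def L2_set_def sum_nonneg)

text \<open>By symmetry the bilinear form B is determined by its quadratic form Q through 4 B(x,y) =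
  Q(x+y) - Q(x-y). The parallelogram law then gives |B(x,y)| \<le> (M/2)(|x|^2 + |y|^2), and for
  vectors of equal norm no constant is lost. Choosing one vector parallel to the conjugate of A v
  turns B into a product of norms.\<close>

lemma symmetric_matrix_norm_le:
  fixes A :: "complex ^ 'n::finite ^ 'n"
  assumes sym: "\<And>j k. A $ j $ k = A $ k $ j"
    and bound: "\<And>u. norm u \<le> 1 \<Longrightarrow> cmod (quadratic_form A u) \<le> M"
  shows "norm (A *v v) \<le> M * norm v"
proof (cases "norm (A *v v) = 0 \<or> norm v = 0")
  case True
  have "M \<ge> 0" using bound[of 0] by simp
  then show ?thesis using True by auto
next
  case False
  have bound': "cmod (quadratic_form A u) \<le> M * (norm u)\<^sup>2" for u
  proof (cases "u = 0")
    case False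
    define e where "e = of_real (inverse (norm u)) *s u"
    have u: "u = of_real (norm u) *s e"
      using False by (simp add: e_def vec_eq_iff)
    have "norm e = cmod (of_real (inverse (norm u))) * norm u"
      unfolding e_def norm_vec_def by (simp add: norm_mult L2_set_right_distrib)
    then have "norm e \<le> 1" using False by (simp add: norm_inverse)
    then have "cmod (quadratic_form A e) \<le> M" by (rule bound)
    then have "(norm u)\<^sup>2 * cmod (quadratic_form A e) \<le> (norm u)\<^sup>2 * M"
      by (intro mult_left_mono) auto
    moreover have "quadratic_form A u = (of_real (norm u))\<^sup>2 * quadratic_form A e"
      unfolding quadratic_form_smult[symmetric] u[symmetric] ..
    ultimately show ?thesis by (simp add: norm_mult norm_power mult.commute)
  qed simp
  define B where "B = (\<lambda>u v. \<Sum>j\<in>UNIV. u $ j * (A *v v) $ j)"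
  have B_sym: "B x y = B y x" for x y
  proof -
    have "B x y = (\<Sum>j\<in>UNIV. \<Sum>k\<in>UNIV. x $ j * (A $ j $ k * y $ k))"
      by (simp add: B_def matrix_vector_mult_def sum_distrib_left)
    also have "\<dots> = (\<Sum>k\<in>UNIV. \<Sum>j\<in>UNIV. x $ j * (A $ j $ k * y $ k))"
      by (rule sum.swap)
    also have "\<dots> = B y x"
      by (simp add: B_def matrix_vector_mult_def sum_distrib_left sym mult_ac)
    finally show ?thesis .
  qed
  have polar: "4 * B x y = quadratic_form A (x + y) - quadratic_form A (x - y)" for x y
  proof -
    have "quadratic_form A (x + y) - quadratic_form A (x - y) = 2 * (B x y + B y x)"
      by (simp add: B_def matrix_vector_right_distrib matrix_vector_mult_diff_distrib
          sum_distrib_left algebra_simps flip: sum_subtractf sum.distrib)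
    then show ?thesis by (simp add: B_sym[of y x])
  qed
  have B_le: "cmod (B x y) \<le> M / 2 * ((norm x)\<^sup>2 + (norm y)\<^sup>2)" for x y
  proof -
    have "4 * cmod (B x y) = cmod (quadratic_form A (x + y) - quadratic_form A (x - y))"
      unfolding polar[symmetric] by (simp add: norm_mult)
    also have "\<dots> \<le> M * (norm (x + y))\<^sup>2 + M * (norm (x - y))\<^sup>2"
      by (rule order_trans[OF norm_triangle_ineq4]) (intro add_mono bound')
    also have "\<dots> = 2 * M * ((norm x)\<^sup>2 + (norm y)\<^sup>2)"
      by (simp add: power2_norm_eq_inner inner_simps inner_commute algebra_simps)
    finally show ?thesis by simp
  qed
  \<comment> \<open>The multiple \<open>y\<close> of the conjugate of \<open>A v\<close> with \<open>|y| = |v|\<close> makes the bilinear form \<open>B y v = |v| |A v|\<close>.\<close>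
  define \<mu> where "\<mu> = norm v / norm (A *v v)"
  define y where "y = (\<chi> j. of_real \<mu> * cnj ((A *v v) $ j))"
  have "\<mu> > 0" using False by (simp add: \<mu>_def)
  have "norm y = cmod (of_real \<mu>) * norm (A *v v)"
    unfolding y_def norm_vec_def by (simp add: norm_mult L2_set_right_distrib)
  then have ny: "norm y = norm v" using False by (simp add: \<mu>_def norm_divide)
  have "B y v = of_real (\<mu> * (\<Sum>j\<in>UNIV. (cmod ((A *v v) $ j))\<^sup>2))"
    unfolding B_def y_def vec_lambda_beta of_real_mult of_real_sum sum_distrib_left
    by (intro sum.cong refl) (simp only: complex_norm_square, simp add: mult_ac)
  then have "B y v = of_real (\<mu> * (norm (A *v v))\<^sup>2)" by (simp add: norm_vec_square)
  then have "\<mu> * (norm (A *v v))\<^sup>2 \<le> M / 2 * ((norm v)\<^sup>2 + (norm v)\<^sup>2)"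
    using B_le[of y v] ny \<open>\<mu> > 0\<close> by (simp add: norm_mult norm_power)
  then have "norm v * norm (A *v v) \<le> norm v * (M * norm v)"
    using False by (simp add: \<mu>_def power2_eq_square mult_ac)
  then show ?thesis using False by (simp add: mult_le_cancel_left)
qed

section \<open>Discs in the half-space, parametrized by \<open>s\<close> and shrinking with
  \<open>t\<close>\<close>

definition parabola :: "complex ^ 'n \<Rightarrow> real \<Rightarrow> complex \<Rightarrow> complex ^ ('n::finite option)" where
  "parabola u t s = (\<chi> i. case i of None \<Rightarrow> \<i> * of_real (t\<^sup>2) | Some j \<Rightarrow> of_real t * s * u $ j)"

lemma parabola_in_siegel:
  assumes "norm u \<le> 1" "cmod s < 1" "0 < t"
  shows "parabola u t s \<in> siegel"
proof -
  have "(\<Sum>j\<in>UNIV. (cmod (of_real t * s * u $ j))\<^sup>2) = (t * cmod s)\<^sup>2 * (norm u)\<^sup>2"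
    by (simp add: norm_vec_square norm_mult sum_distrib_left power_mult_distrib mult_ac)
  also have "\<dots> \<le> (t * cmod s)\<^sup>2 * 1"
    using assms by (intro mult_left_mono) (auto simp: power_le_one)
  also have "\<dots> = (t * cmod s)\<^sup>2" by simp
  also have "\<dots> < t\<^sup>2"
    using assms by (intro power_strict_mono) auto
  finally show ?thesis by (simp add: siegel_def parabola_def Re_power2)
qed

lemma norm_parabola_less:
  assumes "norm u \<le> 1" "cmod s < 1" "0 < t" "t \<le> 1"
  shows "norm (parabola u t s) < 2 * t"
proof -
  have "(norm (parabola u t s))\<^sup>2 = t ^ 4 + (\<Sum>j\<in>UNIV. (cmod (of_real t * s * u $ j))\<^sup>2)"
    by (subst norm_vec_square) (simp add: sum_UNIV_option parabola_def norm_mult norm_power flip: power_mult)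
  also have "(\<Sum>j\<in>UNIV. (cmod (of_real t * s * u $ j))\<^sup>2) \<le> t\<^sup>2"
    using parabola_in_siegel[OF assms(1-3)] by (simp add: siegel_def parabola_def Re_power2)
  also have "t ^ 4 \<le> t\<^sup>2" using assms by (intro power_decreasing) auto
  finally have "(norm (parabola u t s))\<^sup>2 \<le> 2 * t\<^sup>2" by simp
  also have "\<dots> < (2 * t)\<^sup>2" using assms by (simp add: power_mult_distrib)
  finally show ?thesis by (rule power2_less_imp_less) (use assms in simp)
qed

lemma poly_at_parabola_holomorphic: "(\<lambda>s. poly_at p (parabola u t s)) holomorphic_on S"
proof -
  have "(\<lambda>s. parabola u t s $ i) holomorphic_on S" for i
    by (cases i) (auto simp: parabola_def intro!: holomorphic_intros)
  then show ?thesis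
    unfolding poly_at_def monomial_at_def by (intro holomorphic_intros)
qed

text \<open>This is the weighted expansion with \<open>\<rho> = t\<close>, sorted by powers of
  \<open>t\<close>: the z-gradient enters at order 1, while the w-derivative and the Hessian enter
  together at order 2.\<close>

lemma poly_at_parabola_taylor:
  fixes p :: "('n::finite option \<Rightarrow>\<^sub>0 nat) \<Rightarrow>\<^sub>0 complex"
  obtains C where "C \<ge> 0"
    "\<And>u t s. norm u \<le> 1 \<Longrightarrow> cmod s < 1 \<Longrightarrow> 0 < t \<Longrightarrow> t \<le> 1 \<Longrightarrow>
      cmod (poly_at p (parabola u t s) - poly_at p 0 -
        of_real t * s * (\<Sum>j\<in>UNIV. gradient0 (poly_at p) $ Some j * u $ j) -
        of_real (t\<^sup>2) * (\<i> * gradient0 (poly_at p) $ None +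
          (1/2) * s\<^sup>2 * quadratic_form (hessian0 (poly_at p)) u)) \<le> C * t ^ 3"
proof -
  obtain C where C: "C \<ge> 0" "\<And>\<zeta> \<rho>. 0 \<le> \<rho> \<Longrightarrow> \<rho> \<le> 1 \<Longrightarrow> (\<And>j. cmod (\<zeta> $ Some j) \<le> \<rho>) \<Longrightarrow> cmod (\<zeta> $ None) \<le> \<rho>\<^sup>2 \<Longrightarrow>
      cmod (poly_at p \<zeta> - poly_at p 0 - (\<Sum>i\<in>UNIV. gradient0 (poly_at p) $ i * \<zeta> $ i) -
        (1/2) * quadratic_form (hessian0 (poly_at p)) (z_part \<zeta>)) \<le> C * \<rho> ^ 3"
    using poly_weighted_taylor by blast
  show ?thesis
  proof (rule that[OF C(1)])
    fix u :: "complex ^ 'n" and t :: real and s :: complex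
    assume *: "norm u \<le> 1" "cmod s < 1" "0 < t" "t \<le> 1"
    have "cmod s * cmod (u $ j) \<le> 1 * 1" for j
      using * Finite_Cartesian_Product.norm_nth_le[where x = u and i = j] by (intro mult_mono) auto
    then have 1: "cmod (parabola u t s $ Some j) \<le> t" for j
      using * by (simp add: parabola_def norm_mult mult.assoc)
    have 2: "cmod (parabola u t s $ None) \<le> t\<^sup>2"
      by (simp add: parabola_def norm_mult norm_power)
    have 3: "z_part (parabola u t s) = (of_real t * s) *s u"
      by (simp add: parabola_def vec_eq_iff)
    have 4: "(\<Sum>i\<in>UNIV. gradient0 (poly_at p) $ i * parabola u t s $ i) =
        of_real (t\<^sup>2) * (\<i> * gradient0 (poly_at p) $ None) +
        of_real t * s * (\<Sum>j\<in>UNIV. gradient0 (poly_at p) $ Some j * u $ j)"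
      by (simp add: sum_UNIV_option parabola_def sum_distrib_left mult_ac)
    have 5: "poly_at p (parabola u t s) - poly_at p 0 -
        of_real t * s * (\<Sum>j\<in>UNIV. gradient0 (poly_at p) $ Some j * u $ j) -
        of_real (t\<^sup>2) * (\<i> * gradient0 (poly_at p) $ None +
          (1/2) * s\<^sup>2 * quadratic_form (hessian0 (poly_at p)) u) =
        poly_at p (parabola u t s) - poly_at p 0 -
        (\<Sum>i\<in>UNIV. gradient0 (poly_at p) $ i * parabola u t s $ i) -
        (1/2) * quadratic_form (hessian0 (poly_at p)) (z_part (parabola u t s))"
      unfolding 3 4 quadratic_form_smult by (simp add: algebra_simps power_mult_distrib)
    show "cmod (poly_at p (parabola u t s) - poly_at p 0 -
        of_real t * s * (\<Sum>j\<in>UNIV. gradient0 (poly_at p) $ Some j * u $ j) -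
        of_real (t\<^sup>2) * (\<i> * gradient0 (poly_at p) $ None +
          (1/2) * s\<^sup>2 * quadratic_form (hessian0 (poly_at p)) u)) \<le> C * t ^ 3"
      unfolding 5 using * 1 2 by (intro C(2)) auto
  qed
qed

text \<open>Hurwitz's theorem on the unit disc: a nonconstant locally uniform limit of zero-free
  holomorphic functions is zero-free. A limit with a zero at \<open>z\<close> and a nonzero value at
  \<open>s\<close> would be nonconstant.\<close>

lemma nonvanishing_uniform_limit:
  fixes F :: "nat \<Rightarrow> complex \<Rightarrow> complex"
  assumes "\<And>n. F n holomorphic_on ball 0 1" "g holomorphic_on ball 0 1"
    and "\<And>n s. cmod s < 1 \<Longrightarrow> F n s \<noteq> 0"
    and "\<And>n s. cmod s < 1 \<Longrightarrow> cmod (F n s - g s) \<le> e n" "e \<longlonglongrightarrow> 0"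
    and "cmod z < 1" "g z = 0" "cmod s < 1"
  shows "g s = 0"
proof (rule ccontr)
  assume "g s \<noteq> 0"
  then have nc: "\<not> g constant_on ball 0 1"
    using assms(6-8) unfolding constant_on_def by (metis dist_0_norm mem_ball)
  have "uniform_limit K F g sequentially" if "K \<subseteq> ball 0 1" for K
  proof (rule uniform_limitI)
    fix \<epsilon> :: real assume "\<epsilon> > 0"
    with assms(5) have "\<forall>\<^sub>F n in sequentially. e n < \<epsilon>" by (rule order_tendstoD(2))
    then show "\<forall>\<^sub>F n in sequentially. \<forall>x\<in>K. dist (F n x) (g x) < \<epsilon>"
    proof eventually_elim
      case (elim n)
      have "dist (F n x) (g x) < \<epsilon>" if "x \<in> K" for x
        using elim assms(4)[of x n] subsetD[OF \<open>K \<subseteq> ball 0 1\<close> that] by (simp add: dist_norm)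
      then show ?case by blast
    qed
  qed
  then have "g z \<noteq> 0"
    by (intro Hurwitz_no_zeros[of "ball 0 1" F g z]) (use assms nc in auto)
  then show False using assms(7) by simp
qed

lemma nonvanishing_imp_gradient_contractive:
  fixes p :: "('n::finite option \<Rightarrow>\<^sub>0 nat) \<Rightarrow>\<^sub>0 complex"
  assumes "nonvanishing_near0 (poly_at p)" "poly_at p 0 = 0" "gradient0 (poly_at p) \<noteq> 0"
  shows "gradient0 (poly_at p) = gradient0 (poly_at p) $ None *s axis None 1"
    and "contractive ((1 / (2 * norm (gradient0 (poly_at p)))) *\<^sub>R hessian0 (poly_at p))"
proof -
  define g where "g = gradient0 (poly_at p)"
  define H where "H = hessian0 (poly_at p)"
  obtain \<epsilon> where \<epsilon>: "\<epsilon> > 0" "\<And>\<zeta>. \<zeta> \<in> siegel \<Longrightarrow> norm \<zeta> < \<epsilon> \<Longrightarrow> poly_at p \<zeta> \<noteq> 0"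
    using assms(1) by (auto simp: nonvanishing_near0_def)
  obtain C where C: "C \<ge> 0" "\<And>u t s. norm u \<le> 1 \<Longrightarrow> cmod s < 1 \<Longrightarrow> 0 < t \<Longrightarrow> t \<le> 1 \<Longrightarrow>
      cmod (poly_at p (parabola u t s) - 0 -
        of_real t * s * (\<Sum>j\<in>UNIV. g $ Some j * u $ j) -
        of_real (t\<^sup>2) * (\<i> * g $ None + (1/2) * s\<^sup>2 * quadratic_form H u)) \<le> C * t ^ 3"
    unfolding g_def H_def using poly_at_parabola_taylor[of p, unfolded assms(2)] by blast
  \<comment> \<open>The scales tend to 0, and 2 \<open>t n\<close> \<le> \<open>\<epsilon>\<close>
    keeps every disc inside the ball where \<open>p\<close> has no zeros in the half-space.\<close>
  define t where "t = (\<lambda>n. min 1 (\<epsilon> / 2) / (real n + 1))"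
  have t: "0 < t n" "t n \<le> 1" "2 * t n \<le> \<epsilon>" for n
  proof -
    show "0 < t n" using \<epsilon>(1) by (simp add: t_def)
    have "t n \<le> min 1 (\<epsilon> / 2) / 1" unfolding t_def using \<epsilon>(1) by (intro divide_left_mono) auto
    then show "t n \<le> 1" "2 * t n \<le> \<epsilon>" by auto
  qed
  have t_ne: "t n \<noteq> 0" for n using t(1)[of n] by simp
  have t_lim: "t \<longlonglongrightarrow> 0"
    unfolding t_def by real_asymp
  have nz: "poly_at p (parabola u (t n) s) \<noteq> 0" if "norm u \<le> 1" "cmod s < 1" for u s n
    using that t[of n] parabola_in_siegel[of u s "t n"] norm_parabola_less[of u s "t n"] \<epsilon>(2) by force
  \<comment> \<open>First order in \<open>t\<close>: the terms of order 2 join the error, and p/t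
    converges uniformly to \<open>s * a\<close>. This limit vanishes at \<open>s = 0\<close>, hence
    also at \<open>s = 1/2\<close>, so \<open>a = 0\<close>.\<close>
  have lin: "(\<Sum>j\<in>UNIV. g $ Some j * u $ j) = 0" if u: "norm u \<le> 1" for u
  proof -
    define a where "a = (\<Sum>j\<in>UNIV. g $ Some j * u $ j)"
    have "(1/2) * a = 0"
    proof (rule nonvanishing_uniform_limit[where z = 0 and s = "1/2"
          and F = "\<lambda>n s. poly_at p (parabola u (t n) s) / of_real (t n)" and g = "\<lambda>s. s * a"])
      show "(\<lambda>n. t n * (cmod (g $ None) + 1/2 * cmod (quadratic_form H u) + C)) \<longlonglongrightarrow> 0"
        using tendsto_mult_right[OF t_lim] by simp
      fix n and s :: complex assume s: "cmod s < 1"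
      define P where "P = poly_at p (parabola u (t n) s)"
      define W where "W = \<i> * g $ None + (1/2) * s\<^sup>2 * quadratic_form H u"
      have "cmod W \<le> cmod (g $ None) + 1/2 * cmod (quadratic_form H u)"
        unfolding W_def
        using s by (intro order_trans[OF norm_triangle_ineq] add_mono)
           (auto simp: norm_mult norm_power power_le_one mult_left_le_one_le)
      then have W: "(t n)\<^sup>2 * cmod W \<le> (t n)\<^sup>2 * (cmod (g $ None) + 1/2 * cmod (quadratic_form H u))"
        by (intro mult_left_mono) auto
      have "cmod (P - of_real (t n) * s * a) \<le> cmod (P - 0 - of_real (t n) * s * a - of_real ((t n)\<^sup>2) * W) + cmod (of_real ((t n)\<^sup>2) * W)"
        by (rule order_trans[OF _ norm_triangle_ineq]) simp
      also have "\<dots> \<le> C * t n ^ 3 + (t n)\<^sup>2 * cmod W"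
        unfolding P_def a_def W_def by (intro add_mono C(2) u s t) (simp add: norm_mult norm_power)
      also have "C * t n ^ 3 \<le> C * (t n)\<^sup>2"
        using C(1) t[of n] by (intro mult_left_mono power_decreasing) auto
      also note W
      finally have *: "cmod (P - of_real (t n) * s * a) \<le> (t n)\<^sup>2 * (cmod (g $ None) + 1/2 * cmod (quadratic_form H u) + C)"
        by (simp add: algebra_simps)
      have "cmod (P / of_real (t n) - s * a) = cmod (P - of_real (t n) * s * a) / t n"
      proof -
        have "P / of_real (t n) - s * a = (P - of_real (t n) * s * a) / of_real (t n)"
          using t[of n] by (simp add: diff_divide_distrib)
        then show ?thesis using t[of n] by (simp add: norm_divide)
      qed
      also have "\<dots> \<le> t n * (cmod (g $ None) + 1/2 * cmod (quadratic_form H u) + C)"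
        using * t[of n] by (simp add: divide_le_eq power2_eq_square mult_ac)
      finally show "cmod (poly_at p (parabola u (t n) s) / of_real (t n) - s * a) \<le> \<dots>"
        by (simp add: P_def)
      show "poly_at p (parabola u (t n) s) / of_real (t n) \<noteq> 0"
        using nz u s t[of n] by simp
    qed (use t_ne in \<open>auto intro!: holomorphic_intros poly_at_parabola_holomorphic\<close>)
    then show ?thesis by (simp add: a_def)
  qed
  have g_Some: "g $ Some j = 0" for j
  proof -
    have "(\<Sum>k\<in>UNIV. g $ Some k * axis j 1 $ k) = g $ Some j"
      by (simp add: axis_def if_distrib cong: if_cong)
    then show ?thesis using lin[of "axis j 1"] by simp
  qed
  show "gradient0 (poly_at p) = gradient0 (poly_at p) $ None *s axis None 1"
    using g_Some unfolding g_def vec_eq_iff by (auto simp: axis_def split: option.split)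
  have "g \<noteq> 0" using assms(3) by (simp add: g_def)
  then have g_None: "g $ None \<noteq> 0"
    using g_Some by (metis not_None_eq vec_eq_iff zero_index)
  have "(norm g)\<^sup>2 = (cmod (g $ None))\<^sup>2"
    by (subst norm_vec_square) (simp add: sum_UNIV_option g_Some)
  then have norm_g: "norm g = cmod (g $ None)" by simp
  have quad: "cmod (quadratic_form H u) \<le> 2 * norm g" if u: "norm u \<le> 1" for u
  proof (rule ccontr)
    assume "\<not> ?thesis"
    then have gt: "cmod (quadratic_form H u) > 2 * cmod (g $ None)" by (simp add: norm_g)
    define Q where "Q = quadratic_form H u"
    have "Q \<noteq> 0" using gt g_None by (auto simp: Q_def)
    \<comment> \<open>This is a zero of the second-order limit i c + (1/2) s^2 Q, where c =
      \<open>g $ None\<close>. The assumption |Q| > 2|c| says exactly that it lies in the open unit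
      disc. Hurwitz then makes the value i c at \<open>s = 0\<close> vanish, a
      contradiction.\<close>
    define s0 where "s0 = csqrt (- 2 * \<i> * g $ None / Q)"
    have s0: "s0\<^sup>2 = - 2 * \<i> * g $ None / Q" by (simp add: s0_def)
    have "(cmod s0)\<^sup>2 = cmod (s0\<^sup>2)" by (simp add: norm_power)
    also have "\<dots> < 1" unfolding s0 using gt \<open>Q \<noteq> 0\<close> by (simp add: norm_divide norm_mult Q_def)
    finally have "cmod s0 < 1" by (simp add: abs_square_less_1)
    have "\<i> * g $ None + (1/2) * 0\<^sup>2 * Q = 0"
    proof (rule nonvanishing_uniform_limit[where z = s0 and s = 0
          and F = "\<lambda>n s. poly_at p (parabola u (t n) s) / of_real ((t n)\<^sup>2)"
          and g = "\<lambda>s. \<i> * g $ None + (1/2) * s\<^sup>2 * Q"])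
      show "(\<lambda>n. C * t n) \<longlonglongrightarrow> 0"
        using tendsto_mult_left[OF t_lim, of C] by simp
      fix n and s :: complex assume s: "cmod s < 1"
      define P where "P = poly_at p (parabola u (t n) s)"
      define W where "W = \<i> * g $ None + (1/2) * s\<^sup>2 * Q"
      have *: "cmod (P - of_real ((t n)\<^sup>2) * W) \<le> C * t n ^ 3"
        using C(2)[OF u s t(1) t(2), of n] by (simp add: lin[OF u] P_def W_def Q_def)
      have "P / of_real ((t n)\<^sup>2) - W = (P - of_real ((t n)\<^sup>2) * W) / of_real ((t n)\<^sup>2)"
        using t[of n] by (simp add: field_simps)
      then have "cmod (P / of_real ((t n)\<^sup>2) - W) = cmod (P - of_real ((t n)\<^sup>2) * W) / (t n)\<^sup>2"
        by (simp add: norm_divide norm_power)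
      also have "\<dots> \<le> C * t n"
        using * t[of n] by (simp add: divide_le_eq power2_eq_square power3_eq_cube mult_ac)
      finally show "cmod (poly_at p (parabola u (t n) s) / of_real ((t n)\<^sup>2) - (\<i> * g $ None + (1/2) * s\<^sup>2 * Q)) \<le> C * t n"
        by (simp add: P_def W_def)
      show "poly_at p (parabola u (t n) s) / of_real ((t n)\<^sup>2) \<noteq> 0"
        using nz u s t[of n] by simp
    qed (use t_ne s0 \<open>cmod s0 < 1\<close> \<open>Q \<noteq> 0\<close> in \<open>auto intro!: holomorphic_intros poly_at_parabola_holomorphic\<close>)
    then show False using g_None by simp
  qed
  have "norm (H *v v) \<le> 2 * norm g * norm v" for v
    using quad by (intro symmetric_matrix_norm_le) (simp_all add: H_def hessian0_poly_at_symmetric[of p])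
  then have "onorm (\<lambda>v. ((1 / (2 * norm g)) *\<^sub>R H) *v v) \<le> 1"
    using \<open>g \<noteq> 0\<close> by (intro onorm_le) (simp add: scaleR_matrix_vector_mult field_simps)
  then show "contractive ((1 / (2 * norm (gradient0 (poly_at p)))) *\<^sub>R hessian0 (poly_at p))"
    by (simp add: contractive_def g_def H_def)
qed

section \<open>The size of the polynomial on the half-space\<close>

text \<open>On the half-space |z|^2 < Im w \<le> |w|. Hence the square root of |w| is an admissible
  scale \<open>\<rho>\<close> in the weighted expansion.\<close>

lemma siegel_coordinate_le:
  assumes "\<zeta> \<in> siegel"
  shows "cmod (\<zeta> $ Some j) \<le> sqrt (cmod (\<zeta> $ None))" "\<zeta> $ None \<noteq> 0"
    "(norm (z_part \<zeta>))\<^sup>2 \<le> cmod (\<zeta> $ None)"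
proof -
  have 1: "(norm (z_part \<zeta>))\<^sup>2 < Im (\<zeta> $ None)"
    using assms by (simp add: siegel_def norm_vec_square)
  then show 2: "(norm (z_part \<zeta>))\<^sup>2 \<le> cmod (\<zeta> $ None)"
    using abs_Im_le_cmod[of "\<zeta> $ None"] by linarith
  show "\<zeta> $ None \<noteq> 0"
    using 1 zero_le_power2[of "norm (z_part \<zeta>)"] by (metis less_le_not_le order_trans zero_complex.sel(2))
  have "cmod (\<zeta> $ Some j) \<le> norm (z_part \<zeta>)"
    using Finite_Cartesian_Product.norm_nth_le[of "z_part \<zeta>" j] by simp
  also have "\<dots> \<le> sqrt (cmod (\<zeta> $ None))" using 2 by (rule real_le_rsqrt)
  finally show "cmod (\<zeta> $ Some j) \<le> sqrt (cmod (\<zeta> $ None))" .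
qed

text \<open>Since 0 is not in the half-space, the punctured filter loses nothing. This translates
  statements near 0 within the half-space into limits and Landau symbols.\<close>

lemma eventually_at_0_within_siegel:
  "eventually P (at 0 within siegel) \<longleftrightarrow> (\<exists>\<epsilon>>0. \<forall>\<zeta>\<in>siegel \<inter> ball 0 \<epsilon>. P \<zeta>)"
proof -
  have "(0 :: complex ^ ('n::finite option)) \<notin> siegel" by (simp add: siegel_def)
  then show ?thesis
    unfolding eventually_at by (intro iff_exI conj_cong refl) (auto simp: dist_norm)
qed

lemma nonvanishing_near0_iff:
  "nonvanishing_near0 f \<longleftrightarrow> (\<forall>\<^sub>F \<zeta> in at 0 within siegel. f \<zeta> \<noteq> 0)"
  by (simp add: nonvanishing_near0_def eventually_at_0_within_siegel)

lemma bounded_near0_iff_bigo: "bounded_near0 f \<longleftrightarrow> f \<in> O[at 0 within siegel](\<lambda>_. 1)"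
proof
  assume "bounded_near0 f"
  then obtain \<epsilon> B where "\<epsilon> > 0" "\<forall>\<zeta>\<in>siegel \<inter> ball 0 \<epsilon>. norm (f \<zeta>) \<le> B"
    by (auto simp: bounded_near0_def bounded_iff)
  then have "\<forall>\<^sub>F \<zeta> in at 0 within siegel. norm (f \<zeta>) \<le> B * norm (1 :: complex)"
    unfolding eventually_at_0_within_siegel by auto
  then show "f \<in> O[at 0 within siegel](\<lambda>_. 1)" by (rule bigoI)
next
  assume "f \<in> O[at 0 within siegel](\<lambda>_. 1)"
  then obtain c where "\<forall>\<^sub>F \<zeta> in at 0 within siegel. norm (f \<zeta>) \<le> c * norm (1 :: complex)"
    by (elim landau_o.bigE)
  then show "bounded_near0 f"
    by (auto simp: bounded_near0_def bounded_iff eventually_at_0_within_siegel)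
qed

lemma eventually_siegel_None_nonzero: "\<forall>\<^sub>F \<zeta> in at 0 within siegel. \<zeta> $ None \<noteq> 0"
  unfolding eventually_at_0_within_siegel using siegel_coordinate_le(2) zero_less_one by blast

lemma norm_quadratic_form_le: "cmod (quadratic_form A v) \<le> onorm (\<lambda>v. A *v v) * (norm v)\<^sup>2"
proof -
  have "cmod (quadratic_form A v) \<le> (\<Sum>j\<in>UNIV. \<bar>cmod (v $ j)\<bar> * \<bar>cmod ((A *v v) $ j)\<bar>)"
    by (intro sum_norm_le) (simp add: norm_mult)
  also have "\<dots> \<le> norm v * norm (A *v v)"
    unfolding norm_vec_def by (rule L2_set_mult_ineq)
  also have "\<dots> \<le> norm v * (onorm (\<lambda>v. A *v v) * norm v)"
    by (intro mult_left_mono onorm matrix_vector_mul_bounded_linear) auto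
  finally show ?thesis by (simp add: power2_eq_square mult_ac)
qed

text \<open>With \<open>\<kappa> < 1\<close> the norm of the normalized Hessian, half the Hessian
  form is at most |c| \<open>\<kappa>\<close> |z|^2 \<le> \<open>\<kappa>\<close> |c w|, and the
  remainder is O(|w|^(3/2)). So near 0 the distance from \<open>p\<close> to c w is at most a fixed
  fraction, less than 1, of |c w|.\<close>

lemma poly_at_bigtheta:
  fixes p :: "('n::finite option \<Rightarrow>\<^sub>0 nat) \<Rightarrow>\<^sub>0 complex"
  assumes p0: "poly_at p 0 = 0" and c: "c \<noteq> 0" "gradient0 (poly_at p) = c *s axis None 1"
    and sc: "strictly_contractive ((1 / (2 * norm (gradient0 (poly_at p)))) *\<^sub>R hessian0 (poly_at p))"
  shows "poly_at p \<in> \<Theta>[at 0 within siegel](\<lambda>\<zeta>. \<zeta> $ None)"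
proof -
  define g where "g = gradient0 (poly_at p)"
  define H where "H = hessian0 (poly_at p)"
  define K where "K = (1 / (2 * norm g)) *\<^sub>R H"
  define \<kappa> where "\<kappa> = onorm (\<lambda>v. K *v v)"
  have \<kappa>: "0 \<le> \<kappa>" "\<kappa> < 1"
    using sc by (auto simp: \<kappa>_def K_def strictly_contractive_def g_def H_def
        intro: onorm_pos_le matrix_vector_mul_bounded_linear)
  have g: "g $ None = c" "g $ Some j = 0" for j
    using c(2) by (simp_all add: g_def axis_def)
  have "(norm g)\<^sup>2 = (cmod c)\<^sup>2"
    by (subst norm_vec_square) (simp add: sum_UNIV_option g)
  then have norm_g: "norm g = cmod c" by simp
  then have H: "H = (2 * cmod c) *\<^sub>R K" using c(1) by (simp add: K_def)
  have quad: "cmod (quadratic_form H v) \<le> 2 * cmod c * \<kappa> * (norm v)\<^sup>2" for v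
  proof -
    have "quadratic_form H v = of_real (2 * cmod c) * quadratic_form K v"
      unfolding H scaleR_matrix_vector_mult
      by (simp only: vector_scaleR_component mult_scaleR_right scaleR_sum_right[symmetric])
         (simp only: scaleR_conv_of_real)
    then have "cmod (quadratic_form H v) = 2 * cmod c * cmod (quadratic_form K v)"
      by (simp add: norm_mult)
    also have "\<dots> \<le> 2 * cmod c * (\<kappa> * (norm v)\<^sup>2)"
      unfolding \<kappa>_def by (intro mult_left_mono norm_quadratic_form_le) auto
    finally show ?thesis by (simp add: mult_ac)
  qed
  obtain C where C: "C \<ge> 0" "\<And>\<zeta> \<rho>. 0 \<le> \<rho> \<Longrightarrow> \<rho> \<le> 1 \<Longrightarrow> (\<And>j. cmod (\<zeta> $ Some j) \<le> \<rho>) \<Longrightarrow> cmod (\<zeta> $ None) \<le> \<rho>\<^sup>2 \<Longrightarrow>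
      cmod (poly_at p \<zeta> - 0 - (\<Sum>i\<in>UNIV. g $ i * \<zeta> $ i) -
        (1/2) * quadratic_form H (z_part \<zeta>)) \<le> C * \<rho> ^ 3"
    unfolding g_def H_def using poly_weighted_taylor[of p, unfolded p0] by blast
  have est: "cmod (poly_at p \<zeta> - c * \<zeta> $ None) \<le> (cmod c * \<kappa> + C * sqrt (cmod (\<zeta> $ None))) * cmod (\<zeta> $ None)"
    if "\<zeta> \<in> siegel" "norm \<zeta> < 1" for \<zeta>
  proof -
    define \<rho> where "\<rho> = sqrt (cmod (\<zeta> $ None))"
    have "cmod (\<zeta> $ None) \<le> 1"
      using Finite_Cartesian_Product.norm_nth_le[of \<zeta> None] that by simp
    then have \<rho>: "0 \<le> \<rho>" "\<rho> \<le> 1" "\<rho>\<^sup>2 = cmod (\<zeta> $ None)" by (auto simp: \<rho>_def)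
    have "(\<Sum>i\<in>UNIV. g $ i * \<zeta> $ i) = c * \<zeta> $ None" by (simp add: sum_UNIV_option g)
    then have "cmod (poly_at p \<zeta> - c * \<zeta> $ None - (1/2) * quadratic_form H (z_part \<zeta>)) \<le> C * \<rho> ^ 3"
      using C(2)[of \<rho> \<zeta>] \<rho> siegel_coordinate_le(1)[OF that(1)] by (simp add: \<rho>_def)
    moreover have "cmod ((1/2) * quadratic_form H (z_part \<zeta>)) \<le> cmod c * \<kappa> * cmod (\<zeta> $ None)"
    proof -
      have "cmod (quadratic_form H (z_part \<zeta>)) \<le> 2 * cmod c * \<kappa> * (norm (z_part \<zeta>))\<^sup>2" by (rule quad)
      also have "\<dots> \<le> 2 * cmod c * \<kappa> * cmod (\<zeta> $ None)"
        using \<kappa> siegel_coordinate_le(3)[OF that(1)] by (intro mult_left_mono) auto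
      finally show ?thesis by (simp add: norm_mult)
    qed
    ultimately have "cmod (poly_at p \<zeta> - c * \<zeta> $ None) \<le> C * \<rho> ^ 3 + cmod c * \<kappa> * cmod (\<zeta> $ None)"
      using norm_triangle_ineq[of "poly_at p \<zeta> - c * \<zeta> $ None - (1/2) * quadratic_form H (z_part \<zeta>)"
          "(1/2) * quadratic_form H (z_part \<zeta>)"] by simp
    also have "\<rho> ^ 3 = \<rho> * cmod (\<zeta> $ None)"
      by (simp add: \<rho>(3)[symmetric] power3_eq_cube power2_eq_square)
    finally show ?thesis by (simp add: \<rho>_def algebra_simps)
  qed
  \<comment> \<open>Half of the gap |c|(1 - \<open>\<kappa>\<close>). One half absorbs the remainder
    \<open>C * sqrt |w|\<close> near 0, the other survives as the lower bound for |p|/|w|.\<close>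
  define m where "m = cmod c * (1 - \<kappa>) / 2"
  have m: "m > 0" using \<kappa> c(1) by (simp add: m_def)
  have "((\<lambda>\<zeta> :: complex ^ ('n option). C * sqrt (cmod (\<zeta> $ None))) \<longlongrightarrow> C * sqrt (cmod ((0 :: complex ^ ('n option)) $ None))) (at 0 within siegel)"
    by (intro tendsto_intros)
  then have ev: "\<forall>\<^sub>F \<zeta> :: complex ^ ('n option) in at 0 within siegel. C * sqrt (cmod (\<zeta> $ None)) < m"
    using m by (auto dest: order_tendstoD(2))
  have "\<forall>\<^sub>F \<zeta> :: complex ^ ('n option) in at 0 within siegel. \<zeta> \<in> siegel \<and> norm \<zeta> < 1"
    unfolding eventually_at_0_within_siegel by (intro exI[of _ 1]) auto
  with ev have "\<forall>\<^sub>F \<zeta> in at 0 within siegel. m * cmod (\<zeta> $ None) \<le> cmod (poly_at p \<zeta>) \<and>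
      cmod (poly_at p \<zeta>) \<le> (2 * cmod c) * cmod (\<zeta> $ None)"
  proof eventually_elim
    case (elim \<zeta>)
    have "cmod (poly_at p \<zeta> - c * \<zeta> $ None) \<le> (cmod c * \<kappa> + C * sqrt (cmod (\<zeta> $ None))) * cmod (\<zeta> $ None)"
      using elim by (intro est) auto
    also have "\<dots> \<le> (cmod c * \<kappa> + m) * cmod (\<zeta> $ None)"
      using elim by (intro mult_right_mono) auto
    also have "cmod c * \<kappa> + m = cmod c - m" by (simp add: m_def field_simps)
    finally have 1: "cmod (poly_at p \<zeta> - c * \<zeta> $ None) \<le> cmod c * cmod (\<zeta> $ None) - m * cmod (\<zeta> $ None)"
      by (simp add: left_diff_distrib)
    have 2: "0 \<le> m * cmod (\<zeta> $ None)" using m by simp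
    show ?case
      using 1 2 norm_triangle_ineq2[of "c * \<zeta> $ None" "poly_at p \<zeta>"]
        norm_triangle_ineq2[of "poly_at p \<zeta>" "c * \<zeta> $ None"]
      by (simp add: norm_mult norm_minus_commute)
  qed
  then show ?thesis using m c(1) by (intro bigthetaI'[of m "2 * cmod c"]) auto
qed

section \<open>Convergent power series and the ideal\<close>

lemma norm_monomial_at_le_power:
  assumes "norm \<zeta> \<le> \<delta>"
  shows "cmod (monomial_at \<alpha> \<zeta>) \<le> \<delta> ^ total_degree \<alpha>"
proof -
  have "cmod (\<zeta> $ i) \<le> \<delta>" for i
    using Finite_Cartesian_Product.norm_nth_le[of \<zeta> i] assms by linarith
  then have "cmod (monomial_at \<alpha> \<zeta>) \<le> (\<Prod>i\<in>UNIV. \<delta> ^ Poly_Mapping.lookup \<alpha> i)"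
    unfolding monomial_at_def prod_norm[symmetric] norm_power
    by (intro prod_mono conjI power_mono) auto
  then show ?thesis by (simp add: total_degree_def power_sum)
qed

lemma power_series_summable:
  assumes "(\<lambda>\<alpha>. cmod (c \<alpha>) * \<delta> ^ total_degree \<alpha>) summable_on UNIV" "norm \<zeta> \<le> \<delta>"
  shows "(\<lambda>\<alpha>. cmod (c \<alpha> * monomial_at \<alpha> \<zeta>)) summable_on UNIV"
  by (rule Infinite_Sum.abs_summable_on_comparison_test'[OF assms(1)])
     (simp add: norm_mult mult_left_mono norm_monomial_at_le_power assms(2))

lemma power_series_analytic:
  assumes "(\<lambda>\<alpha>. cmod (c \<alpha>) * \<delta> ^ total_degree \<alpha>) summable_on UNIV" "\<delta> > 0"
  shows "analytic_near0 (\<lambda>\<zeta>. \<Sum>\<^sub>\<infinity>\<alpha>. c \<alpha> * monomial_at \<alpha> \<zeta>)"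
  unfolding analytic_near0_def
  using assms(2) by (intro exI[of _ c] exI[of _ \<delta>] conjI ballI has_sum_infsum
      abs_summable_summable[OF power_series_summable[OF assms(1)]]) (simp_all add: dist_norm)

text \<open>Unconditional convergence of complex series is absolute. Applied at one point with all
  coordinates equal to \<open>\<delta>\<close>, it yields a majorant that depends on exponents only
  through their total degree and controls the series on the whole ball of radius
  \<open>\<delta>\<close>.\<close>

lemma analytic_near0E:
  fixes q :: "complex ^ 'v::finite \<Rightarrow> complex"
  assumes "analytic_near0 q"
  obtains c \<delta> where "\<delta> > 0" "(\<lambda>\<alpha>. cmod (c \<alpha>) * \<delta> ^ total_degree \<alpha>) summable_on UNIV"
    "\<And>\<zeta>. norm \<zeta> < \<delta> \<Longrightarrow> ((\<lambda>\<alpha>. c \<alpha> * monomial_at \<alpha> \<zeta>) has_sum q \<zeta>) UNIV"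
proof -
  obtain c r where r: "r > 0" and "\<forall>\<zeta>\<in>ball 0 r. ((\<lambda>\<alpha>. c \<alpha> * monomial_at \<alpha> \<zeta>) has_sum q \<zeta>) UNIV"
    using assms unfolding analytic_near0_def by blast
  then have c: "((\<lambda>\<alpha>. c \<alpha> * monomial_at \<alpha> \<zeta>) has_sum q \<zeta>) UNIV" if "norm \<zeta> < r" for \<zeta>
    using that by (simp add: dist_norm)
  \<comment> \<open>The point with all coordinates \<open>\<delta>\<close> has norm at most
    \<open>CARD('v) * \<delta>\<close>, which must stay below \<open>r\<close>.\<close>
  define \<delta> where "\<delta> = r / (real CARD('v) + 1)"
  have \<delta>: "\<delta> > 0" "real CARD('v) * \<delta> < r" "\<delta> \<le> r" using r by (auto simp: \<delta>_def field_simps)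
  define D :: "complex ^ 'v" where "D = (\<chi> i. of_real \<delta>)"
  have "norm D \<le> (\<Sum>i\<in>UNIV. norm (D $ i))"
    unfolding norm_vec_def by (intro L2_set_le_sum) auto
  then have "norm D < r" using \<delta> by (simp add: D_def)
  from c[OF this] have "(\<lambda>\<alpha>. cmod (c \<alpha> * monomial_at \<alpha> D)) summable_on UNIV"
    by (intro summable_on_iff_abs_summable_on_complex[THEN iffD1] has_sum_imp_summable)
  moreover have "cmod (c \<alpha> * monomial_at \<alpha> D) = cmod (c \<alpha>) * \<delta> ^ total_degree \<alpha>" for \<alpha>
    using \<delta> by (simp add: D_def monomial_at_def norm_mult norm_power total_degree_def power_sum flip: prod_norm)
  ultimately have "(\<lambda>\<alpha>. cmod (c \<alpha>) * \<delta> ^ total_degree \<alpha>) summable_on UNIV" by simp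
  then show ?thesis using \<delta> c by (intro that[of \<delta> c]) auto
qed

lemma analytic_near0_bigo_1:
  assumes "analytic_near0 q"
  shows "q \<in> O[nhds 0](\<lambda>_. 1)"
proof -
  obtain c \<delta> where \<delta>: "\<delta> > 0" and sm: "(\<lambda>\<alpha>. cmod (c \<alpha>) * \<delta> ^ total_degree \<alpha>) summable_on UNIV"
    and q: "\<And>\<zeta>. norm \<zeta> < \<delta> \<Longrightarrow> ((\<lambda>\<alpha>. c \<alpha> * monomial_at \<alpha> \<zeta>) has_sum q \<zeta>) UNIV"
    using analytic_near0E[OF assms] by blast
  define M where "M = (\<Sum>\<^sub>\<infinity>\<alpha>. cmod (c \<alpha>) * \<delta> ^ total_degree \<alpha>)"
  have "cmod (q \<zeta>) \<le> M" if "norm \<zeta> < \<delta>" for \<zeta>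
  proof -
    have abs: "(\<lambda>\<alpha>. cmod (c \<alpha> * monomial_at \<alpha> \<zeta>)) summable_on UNIV"
      using that by (intro power_series_summable[OF sm]) auto
    have "cmod (q \<zeta>) \<le> (\<Sum>\<^sub>\<infinity>\<alpha>. cmod (c \<alpha> * monomial_at \<alpha> \<zeta>))"
      using norm_infsum_bound[OF abs] infsumI[OF q[OF that]] by simp
    also have "\<dots> \<le> M"
      unfolding M_def using that
      by (intro infsum_mono abs sm) (auto simp: norm_mult intro!: mult_left_mono norm_monomial_at_le_power)
    finally show ?thesis .
  qed
  then have "\<forall>\<^sub>F \<zeta> in nhds 0. cmod (q \<zeta>) \<le> M * cmod 1"
    unfolding eventually_nhds_metric using \<delta> by (auto simp: dist_norm)
  then show ?thesis by (rule bigoI)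
qed

lemma analytic_near0_const: "analytic_near0 (\<lambda>_. k)"
proof -
  have "((\<lambda>\<alpha>. (if \<alpha> = 0 then k else 0) * monomial_at \<alpha> \<zeta>) has_sum k) UNIV" for \<zeta>
    by (rule has_sum_finite_neutralI[of "{0}"]) (auto simp: monomial_at_def)
  then show ?thesis
    unfolding analytic_near0_def
    by (intro exI[of _ "\<lambda>\<alpha>. if \<alpha> = 0 then k else 0"] exI[of _ 1]) auto
qed

text \<open>
  Each exponent outside \<open>L\<close> is assigned one of its divisors in \<open>\<Gamma>\<close>; the terms assigned to \<open>\<gamma>\<close>,
  divided by the monomial \<open>\<gamma>\<close>, form the series of the coefficient \<open>a \<gamma>\<close>.
\<close>

lemma analytic_near0_monomial_division:
  fixes q :: "complex ^ 'v::finite \<Rightarrow> complex"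
  assumes "analytic_near0 q" "finite L" "finite \<Gamma>"
    and div: "\<And>\<alpha>. \<alpha> \<notin> L \<Longrightarrow> \<exists>\<gamma>\<in>\<Gamma>. \<exists>\<beta>. \<alpha> = \<beta> + \<gamma>"
  obtains d a where "\<And>\<gamma>. analytic_near0 (a \<gamma>)"
    "\<forall>\<^sub>F \<zeta> in nhds 0. q \<zeta> = (\<Sum>\<alpha>\<in>L. d \<alpha> * monomial_at \<alpha> \<zeta>) + (\<Sum>\<gamma>\<in>\<Gamma>. a \<gamma> \<zeta> * monomial_at \<gamma> \<zeta>)"
proof -
  obtain c \<delta> where \<delta>: "\<delta> > 0" and sm: "(\<lambda>\<alpha>. cmod (c \<alpha>) * \<delta> ^ total_degree \<alpha>) summable_on UNIV"
    and q: "\<And>\<zeta>. norm \<zeta> < \<delta> \<Longrightarrow> ((\<lambda>\<alpha>. c \<alpha> * monomial_at \<alpha> \<zeta>) has_sum q \<zeta>) UNIV"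
    using analytic_near0E[OF assms(1)] by blast
  \<comment> \<open>An exponent may have several divisors in \<open>\<Gamma>\<close>; fixing one
    choice ensures that its term is counted once.\<close>
  obtain ch where ch: "\<And>\<alpha>. \<alpha> \<notin> L \<Longrightarrow> ch \<alpha> \<in> \<Gamma> \<and> (\<exists>\<beta>. \<alpha> = \<beta> + ch \<alpha>)"
    using div by metis
  define B where "B = (\<lambda>\<gamma>. {\<beta>. \<beta> + \<gamma> \<notin> L \<and> ch (\<beta> + \<gamma>) = \<gamma>})"
  define A where "A = (\<lambda>\<gamma>. (\<lambda>\<beta>. \<beta> + \<gamma>) ` B \<gamma>)"
  define e where "e = (\<lambda>\<gamma> \<beta>. if \<beta> \<in> B \<gamma> then c (\<beta> + \<gamma>) else 0)"
  define a where "a = (\<lambda>\<gamma> \<zeta>. \<Sum>\<^sub>\<infinity>\<beta>. e \<gamma> \<beta> * monomial_at \<beta> \<zeta>)"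
  have inj: "inj_on (\<lambda>\<beta>. \<beta> + \<gamma>) S" for \<gamma> :: "'v \<Rightarrow>\<^sub>0 nat" and S by (simp add: inj_on_def)
  \<comment> \<open>Division by the monomial \<open>\<gamma>\<close> costs only the constant factor
    \<open>\<delta>\<close> to the power -\<open>total_degree \<gamma>\<close>, so every quotient
    series keeps a convergent majorant at the same radius.\<close>
  have e_sm: "(\<lambda>\<beta>. cmod (e \<gamma> \<beta>) * \<delta> ^ total_degree \<beta>) summable_on UNIV" for \<gamma>
  proof -
    have "(\<lambda>\<alpha>. cmod (c \<alpha>) * \<delta> ^ total_degree \<alpha>) summable_on (range (\<lambda>\<beta>. \<beta> + \<gamma>))"
      using sm by (rule summable_on_subset_banach) auto
    then have "(\<lambda>\<beta>. cmod (c (\<beta> + \<gamma>)) * \<delta> ^ total_degree (\<beta> + \<gamma>)) summable_on UNIV"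
      by (subst (asm) summable_on_reindex[OF inj]) (simp add: o_def)
    then have sm': "(\<lambda>\<beta>. inverse (\<delta> ^ total_degree \<gamma>) * (cmod (c (\<beta> + \<gamma>)) * \<delta> ^ total_degree (\<beta> + \<gamma>))) summable_on UNIV"
      by (rule summable_on_cmult_right)
    have *: "norm (cmod (e \<gamma> \<beta>) * \<delta> ^ total_degree \<beta>) \<le>
        inverse (\<delta> ^ total_degree \<gamma>) * (cmod (c (\<beta> + \<gamma>)) * \<delta> ^ total_degree (\<beta> + \<gamma>))" for \<beta>
      using \<delta> by (simp add: e_def total_degree_add power_add field_simps)
    from sm' have "(\<lambda>\<beta>. norm (cmod (e \<gamma> \<beta>) * \<delta> ^ total_degree \<beta>)) summable_on UNIV"
      by (rule Infinite_Sum.abs_summable_on_comparison_test'[OF _ *])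
    then show ?thesis by (rule abs_summable_summable)
  qed
  have A_ch: "ch \<alpha> = \<gamma>" if "\<alpha> \<in> A \<gamma>" for \<alpha> \<gamma>
    using that unfolding A_def B_def by blast
  have A_L: "\<alpha> \<notin> L" if "\<alpha> \<in> A \<gamma>" for \<alpha> \<gamma>
    using that unfolding A_def B_def by blast
  have in_A: "\<alpha> \<in> A (ch \<alpha>) \<and> ch \<alpha> \<in> \<Gamma>" if "\<alpha> \<notin> L" for \<alpha>
  proof -
    obtain \<beta> where "ch \<alpha> \<in> \<Gamma>" and \<beta>: "\<alpha> = \<beta> + ch \<alpha>" using ch[OF \<open>\<alpha> \<notin> L\<close>] by blast
    moreover have "\<beta> \<in> B (ch \<alpha>)" using \<open>\<alpha> \<notin> L\<close> by (simp add: B_def flip: \<beta>)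
    ultimately show ?thesis unfolding A_def by blast
  qed
  \<comment> \<open>The set \<open>L\<close> and the sets \<open>A \<gamma>\<close> partition all
    exponents, so the power series of \<open>q\<close> splits into the corresponding partial
    sums.\<close>
  have UN: "L \<union> (\<Union>\<gamma>\<in>\<Gamma>. A \<gamma>) = UNIV" using in_A by (intro set_eqI) blast
  have disj: "L \<inter> (\<Union>\<gamma>\<in>\<Gamma>. A \<gamma>) = {}" using A_L by blast
  have "q \<zeta> = (\<Sum>\<alpha>\<in>L. c \<alpha> * monomial_at \<alpha> \<zeta>) + (\<Sum>\<gamma>\<in>\<Gamma>. a \<gamma> \<zeta> * monomial_at \<gamma> \<zeta>)"
    if \<zeta>: "norm \<zeta> < \<delta>" for \<zeta>
  proof -
    have "((\<lambda>\<alpha>. c \<alpha> * monomial_at \<alpha> \<zeta>) has_sum (a \<gamma> \<zeta> * monomial_at \<gamma> \<zeta>)) (A \<gamma>)" for \<gamma>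
    proof -
      have "((\<lambda>\<beta>. e \<gamma> \<beta> * monomial_at \<beta> \<zeta>) has_sum a \<gamma> \<zeta>) UNIV"
        unfolding a_def using \<zeta>
        by (intro has_sum_infsum abs_summable_summable[OF power_series_summable[OF e_sm]]) simp
      then have "((\<lambda>\<beta>. e \<gamma> \<beta> * monomial_at \<beta> \<zeta> * monomial_at \<gamma> \<zeta>) has_sum a \<gamma> \<zeta> * monomial_at \<gamma> \<zeta>) UNIV"
        by (rule has_sum_cmult_left)
      also have "?this \<longleftrightarrow> ((\<lambda>\<beta>. c (\<beta> + \<gamma>) * monomial_at (\<beta> + \<gamma>) \<zeta>) has_sum a \<gamma> \<zeta> * monomial_at \<gamma> \<zeta>) (B \<gamma>)"
        by (intro has_sum_cong_neutral) (auto simp: e_def monomial_at_add)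
      finally show ?thesis
        unfolding A_def has_sum_reindex[OF inj] by (simp add: o_def)
    qed
    then have "((\<lambda>\<alpha>. c \<alpha> * monomial_at \<alpha> \<zeta>) has_sum (\<Sum>\<gamma>\<in>\<Gamma>. a \<gamma> \<zeta> * monomial_at \<gamma> \<zeta>)) (\<Union>\<gamma>\<in>\<Gamma>. A \<gamma>)"
      using assms(3) A_ch by (intro sum_has_sum) blast+
    moreover have "((\<lambda>\<alpha>. c \<alpha> * monomial_at \<alpha> \<zeta>) has_sum (\<Sum>\<alpha>\<in>L. c \<alpha> * monomial_at \<alpha> \<zeta>)) L"
      using assms(2) by (simp add: has_sum_finite_iff)
    ultimately have "((\<lambda>\<alpha>. c \<alpha> * monomial_at \<alpha> \<zeta>) has_sum
        ((\<Sum>\<alpha>\<in>L. c \<alpha> * monomial_at \<alpha> \<zeta>) + (\<Sum>\<gamma>\<in>\<Gamma>. a \<gamma> \<zeta> * monomial_at \<gamma> \<zeta>))) UNIV"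
      unfolding UN[symmetric] using disj by (intro has_sum_Un_disjoint)
    then show ?thesis using q[OF \<zeta>] has_sum_unique by blast
  qed
  then have "\<forall>\<^sub>F \<zeta> in nhds 0. q \<zeta> = (\<Sum>\<alpha>\<in>L. c \<alpha> * monomial_at \<alpha> \<zeta>) + (\<Sum>\<gamma>\<in>\<Gamma>. a \<gamma> \<zeta> * monomial_at \<gamma> \<zeta>)"
    unfolding eventually_nhds_metric using \<delta> by (auto simp: dist_norm)
  then show ?thesis
    using power_series_analytic[OF e_sm \<delta>] by (intro that[of a c]) (auto simp: a_def)
qed

text \<open>Coefficients in a generated ideal are indexed by generator functions, those from
  division by exponents. Injectivity allows passing from one to the other.\<close>

lemma inj_monomial_at: "inj (monomial_at :: ('v::finite \<Rightarrow>\<^sub>0 nat) \<Rightarrow> _)"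
proof (rule injI)
  fix \<alpha> \<beta> :: "'v \<Rightarrow>\<^sub>0 nat"
  assume eq: "monomial_at \<alpha> = monomial_at \<beta>"
  show "\<alpha> = \<beta>"
  proof (rule poly_mapping_eqI)
    fix i
    \<comment> \<open>At this point a monomial equals 2 to the power of its \<open>i\<close>-th
      exponent, which can be read off from the modulus.\<close>
    define \<zeta> :: "complex ^ 'v" where "\<zeta> = (\<chi> j. if j = i then 2 else 1)"
    have *: "monomial_at \<gamma> \<zeta> = 2 ^ Poly_Mapping.lookup \<gamma> i" for \<gamma>
    proof -
      have "monomial_at \<gamma> \<zeta> = (\<Prod>j\<in>UNIV. if j = i then 2 ^ Poly_Mapping.lookup \<gamma> i else 1)"
        unfolding monomial_at_def by (rule prod.cong) (auto simp: \<zeta>_def)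
      then show ?thesis by simp
    qed
    have "(2 :: complex) ^ Poly_Mapping.lookup \<alpha> i = 2 ^ Poly_Mapping.lookup \<beta> i"
      using eq by (simp flip: *)
    then have "norm ((2 :: complex) ^ Poly_Mapping.lookup \<alpha> i) = norm ((2 :: complex) ^ Poly_Mapping.lookup \<beta> i)"
      by simp
    then show "Poly_Mapping.lookup \<alpha> i = Poly_Mapping.lookup \<beta> i"
      by (simp add: norm_power)
  qed
qed

section \<open>Membership in the ideals and growth on the half-space\<close>

lemma generated_ideal_monomialI:
  assumes "finite \<Gamma>" "monomial_at ` \<Gamma> \<subseteq> S" "\<And>\<gamma>. analytic_near0 (a \<gamma>)"
    and "\<forall>\<^sub>F \<zeta> in nhds 0. f \<zeta> = (\<Sum>\<gamma>\<in>\<Gamma>. a \<gamma> \<zeta> * monomial_at \<gamma> \<zeta>)"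
  shows "f \<in> generated_ideal S"
proof -
  have "(\<Sum>g\<in>monomial_at ` \<Gamma>. a (inv monomial_at g) \<zeta> * g \<zeta>) =
      (\<Sum>\<gamma>\<in>\<Gamma>. a \<gamma> \<zeta> * monomial_at \<gamma> \<zeta>)" for \<zeta>
    by (subst sum.reindex[OF inj_on_subset[OF inj_monomial_at subset_UNIV]])
       (simp add: inv_f_f[OF inj_monomial_at])
  then have "\<forall>\<^sub>F \<zeta> in nhds 0. f \<zeta> = (\<Sum>g\<in>monomial_at ` \<Gamma>. a (inv monomial_at g) \<zeta> * g \<zeta>)"
    using assms(4) by simp
  then show ?thesis
    unfolding generated_ideal_def mem_Collect_eq using assms(1-3)
    by (intro exI[of _ "monomial_at ` \<Gamma>"] exI[of _ "\<lambda>g. a (inv monomial_at g)"]) simp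
qed

lemma generated_ideal_superset: "S \<subseteq> generated_ideal S"
proof
  fix g assume "g \<in> S"
  then show "g \<in> generated_ideal S"
    unfolding generated_ideal_def mem_Collect_eq
    by (intro exI[of _ "{g}"] exI[of _ "\<lambda>_ _. 1"]) (simp add: analytic_near0_const)
qed

text \<open>The coefficients are bounded near 0, so a growth bound for the generators passes to the
  ideal. It is applied first to the ideal of quadratic monomials and then to the ideal that this one
  generates together with \<open>w\<close>.\<close>

lemma generated_ideal_bigo:
  assumes "f \<in> generated_ideal S" "\<And>g. g \<in> S \<Longrightarrow> g \<in> O[at 0 within A](h)"
  shows "f \<in> O[at 0 within A](h)"
proof -
  obtain T a where T: "finite T" "T \<subseteq> S" "\<And>g. g \<in> T \<Longrightarrow> analytic_near0 (a g)"
    and f: "\<forall>\<^sub>F \<zeta> in nhds 0. f \<zeta> = (\<Sum>g\<in>T. a g \<zeta> * g \<zeta>)"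
    using assms(1) by (auto simp: generated_ideal_def)
  have "(\<lambda>\<zeta>. a g \<zeta> * g \<zeta>) \<in> O[at 0 within A](h)" if "g \<in> T" for g
  proof -
    have "a g \<in> O[at 0 within A](\<lambda>_. 1)"
      using analytic_near0_bigo_1[OF T(3)[OF that]] landau_o.big.filter_mono[OF at_within_le_nhds] by blast
    from landau_o.big.mult[OF this] show ?thesis using that T(2) assms(2) by force
  qed
  then have "(\<lambda>\<zeta>. \<Sum>g\<in>T. a g \<zeta> * g \<zeta>) \<in> O[at 0 within A](h)" by (rule big_sum_in_bigo)
  moreover have "\<forall>\<^sub>F \<zeta> in at 0 within A. f \<zeta> = (\<Sum>g\<in>T. a g \<zeta> * g \<zeta>)"
    using f at_within_le_nhds by (rule filter_leD[rotated])
  ultimately show ?thesis by (simp add: landau_o.big.in_cong)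
qed

lemma z_squared_ideal_bigo:
  assumes "f \<in> z_squared_ideal"
  shows "f \<in> O[at 0 within siegel](\<lambda>\<zeta>. \<zeta> $ None)"
  using assms unfolding z_squared_ideal_def
proof (rule generated_ideal_bigo)
  fix g :: "complex ^ ('a option) \<Rightarrow> complex"
  assume "g \<in> {\<lambda>\<zeta>. \<Prod>j\<in>UNIV. (\<zeta> $ Some j) ^ \<alpha> j | \<alpha>. (\<Sum>j\<in>UNIV. \<alpha> j) = 2}"
  then obtain \<alpha> where g: "g = (\<lambda>\<zeta>. \<Prod>j\<in>UNIV. (\<zeta> $ Some j) ^ \<alpha> j)" and \<alpha>: "(\<Sum>j\<in>UNIV. \<alpha> j) = 2"
    by blast
  have "cmod (g \<zeta>) \<le> cmod (\<zeta> $ None)" if "\<zeta> \<in> siegel" for \<zeta>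
  proof -
    have "cmod (g \<zeta>) = (\<Prod>j\<in>UNIV. cmod (\<zeta> $ Some j) ^ \<alpha> j)"
      by (simp add: g norm_power flip: prod_norm)
    also have "\<dots> \<le> (\<Prod>j\<in>UNIV. sqrt (cmod (\<zeta> $ None)) ^ \<alpha> j)"
      by (intro prod_mono conjI power_mono siegel_coordinate_le(1) that) auto
    also have "\<dots> = sqrt (cmod (\<zeta> $ None)) ^ 2"
      unfolding \<alpha>[symmetric] by (simp add: power_sum)
    finally show ?thesis by simp
  qed
  then have "\<forall>\<^sub>F \<zeta> in at 0 within siegel. cmod (g \<zeta>) \<le> 1 * cmod (\<zeta> $ None)"
    unfolding eventually_at_0_within_siegel by (intro exI[of _ 1]) auto
  then show "g \<in> O[at 0 within siegel](\<lambda>\<zeta>. \<zeta> $ None)" by (rule bigoI)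
qed

lemma w_z_squared_ideal_bigo:
  assumes "f \<in> w_z_squared_ideal"
  shows "f \<in> O[at 0 within siegel](\<lambda>\<zeta>. \<zeta> $ None)"
  using assms unfolding w_z_squared_ideal_def
  by (rule generated_ideal_bigo) (auto intro: z_squared_ideal_bigo)

lemma monomial_degree_2_in_z_squared_ideal:
  "monomial_at (Poly_Mapping.single (Some j) 1 + Poly_Mapping.single (Some k) 1) \<in> z_squared_ideal"
proof -
  define \<alpha> where "\<alpha> = Poly_Mapping.single (Some j) 1 + Poly_Mapping.single (Some k) (1::nat)"
  have single_sum: "(\<Sum>i\<in>UNIV. Poly_Mapping.lookup (Poly_Mapping.single (Some j) (1::nat)) (Some i)) = 1"
    for j :: 'a
  proof -
    have "(\<Sum>i\<in>UNIV. Poly_Mapping.lookup (Poly_Mapping.single (Some j) (1::nat)) (Some i)) =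
        (\<Sum>i\<in>UNIV. if i = j then 1 else 0)"
      by (rule sum.cong) (auto simp: lookup_single when_def)
    then show ?thesis by simp
  qed
  have "(\<Sum>i\<in>UNIV. Poly_Mapping.lookup \<alpha> (Some i)) = 2"
    unfolding \<alpha>_def lookup_add sum.distrib single_sum by simp
  moreover have "monomial_at \<alpha> = (\<lambda>\<zeta>. \<Prod>i\<in>UNIV. (\<zeta> $ Some i) ^ Poly_Mapping.lookup \<alpha> (Some i))"
    by (simp add: fun_eq_iff monomial_at_def prod_UNIV_option) (simp add: \<alpha>_def lookup_add lookup_single)
  ultimately show ?thesis
    unfolding z_squared_ideal_def \<alpha>_def[symmetric]
    by (intro subsetD[OF generated_ideal_superset] CollectI exI[of _ "\<lambda>i. Poly_Mapping.lookup \<alpha> (Some i)"]) auto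
qed

text \<open>Monomial division with \<open>L\<close> the exponents of 1 and of the z_j, and
  \<open>\<Gamma>\<close> those of \<open>w\<close> and of the products z_j z_k. A monomial outside
  \<open>L\<close> contains \<open>w\<close> or at least two factors z_j, so it has a divisor in
  \<open>\<Gamma>\<close>.\<close>

lemma analytic_near0_decomposition:
  fixes q :: "complex ^ ('n::finite option) \<Rightarrow> complex"
  assumes "analytic_near0 q"
  obtains d0 d m where "m \<in> w_z_squared_ideal"
    "\<forall>\<^sub>F \<zeta> in nhds 0. q \<zeta> = d0 + (\<Sum>j\<in>UNIV. d j * \<zeta> $ Some j) + m \<zeta>"
proof -
  define e :: "'n option \<Rightarrow> 'n option \<Rightarrow>\<^sub>0 nat" where "e = (\<lambda>i. Poly_Mapping.single i 1)"
  define L where "L = insert 0 (range (\<lambda>j. e (Some j)))"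
  define \<Gamma> where "\<Gamma> = insert (e None) (range (\<lambda>(j, k). e (Some j) + e (Some k)))"
  have split: "\<exists>i. \<alpha> = (\<alpha> - e i) + e i \<and> Poly_Mapping.lookup \<alpha> i > 0" if "\<alpha> \<noteq> 0" for \<alpha>
  proof -
    obtain i where "Poly_Mapping.lookup \<alpha> i > 0"
      using \<open>\<alpha> \<noteq> 0\<close> by (metis lookup_zero neq0_conv poly_mapping_eqI)
    then show ?thesis using single_add_minus[of \<alpha> i] by (intro exI[of _ i]) (simp add: e_def add.commute)
  qed
  have div: "\<exists>\<gamma>\<in>\<Gamma>. \<exists>\<beta>. \<alpha> = \<beta> + \<gamma>" if "\<alpha> \<notin> L" for \<alpha>
  proof -
    have "\<alpha> \<noteq> 0" using that by (auto simp: L_def)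
    then obtain i where i: "\<alpha> = (\<alpha> - e i) + e i" using split by blast
    show ?thesis
    proof (cases i)
      case None
      then show ?thesis using i by (auto simp: \<Gamma>_def)
    next
      case (Some j)
      have "\<alpha> - e i \<noteq> 0"
      proof
        assume "\<alpha> - e i = 0"
        then have "\<alpha> = e i" using i by simp
        then show False using that Some by (simp add: L_def)
      qed
      then obtain k where k: "\<alpha> - e i = (\<alpha> - e i - e k) + e k" using split by blast
      show ?thesis
      proof (cases k)
        case None
        then have "\<alpha> = (\<alpha> - e i - e k + e i) + e None"
          using i k by (metis add.assoc add.commute)
        then show ?thesis by (auto simp: \<Gamma>_def)
      next
        case (Some l)
        then have "\<alpha> = (\<alpha> - e i - e k) + (e (Some l) + e (Some j))"
          using i k \<open>i = Some j\<close> by (metis add.assoc)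
        moreover have "e (Some l) + e (Some j) \<in> \<Gamma>"
          unfolding \<Gamma>_def by (rule insertI2) (rule image_eqI[of _ _ "(l, j)"], auto)
        ultimately show ?thesis by blast
      qed
    qed
  qed
  have fin: "finite L" "finite \<Gamma>" by (simp_all add: L_def \<Gamma>_def)
  obtain c a where a: "\<And>\<gamma>. analytic_near0 (a \<gamma>)"
    and q: "\<forall>\<^sub>F \<zeta> in nhds 0. q \<zeta> = (\<Sum>\<alpha>\<in>L. c \<alpha> * monomial_at \<alpha> \<zeta>) + (\<Sum>\<gamma>\<in>\<Gamma>. a \<gamma> \<zeta> * monomial_at \<gamma> \<zeta>)"
    by (rule analytic_near0_monomial_division[OF assms fin div], assumption, rule that)
  have "monomial_at (e None) = (\<lambda>\<zeta>. \<zeta> $ None)"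
    by (simp add: e_def monomial_at_single fun_eq_iff)
  then have "monomial_at ` \<Gamma> \<subseteq> insert (\<lambda>\<zeta>. \<zeta> $ None) z_squared_ideal"
    using monomial_degree_2_in_z_squared_ideal by (auto simp: \<Gamma>_def e_def)
  then have ideal: "(\<lambda>\<zeta>. \<Sum>\<gamma>\<in>\<Gamma>. a \<gamma> \<zeta> * monomial_at \<gamma> \<zeta>) \<in> w_z_squared_ideal"
    unfolding w_z_squared_ideal_def
    by (intro generated_ideal_monomialI[where a = a, OF fin(2)] a) auto
  have lookup_e: "Poly_Mapping.lookup (e i) i = 1" for i by (simp add: e_def)
  have e_inj: "inj (\<lambda>j. e (Some j))"
  proof (rule injI)
    fix j k assume "e (Some j) = e (Some k)"
    then have "Poly_Mapping.lookup (e (Some j)) (Some k) = 1" using lookup_e by simp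
    then show "j = k" by (simp add: e_def lookup_single when_def split: if_splits)
  qed
  have e_nz: "e i \<noteq> 0" for i using lookup_e[of i] by auto
  have "(\<Sum>\<alpha>\<in>L. c \<alpha> * monomial_at \<alpha> \<zeta>) = c 0 + (\<Sum>j\<in>UNIV. c (e (Some j)) * \<zeta> $ Some j)" for \<zeta>
  proof -
    have "(\<Sum>\<alpha>\<in>L. c \<alpha> * monomial_at \<alpha> \<zeta>) =
        c 0 * monomial_at 0 \<zeta> + (\<Sum>\<alpha>\<in>range (\<lambda>j. e (Some j)). c \<alpha> * monomial_at \<alpha> \<zeta>)"
      unfolding L_def by (rule sum.insert) (simp_all add: image_iff e_nz[symmetric])
    also have "(\<Sum>\<alpha>\<in>range (\<lambda>j. e (Some j)). c \<alpha> * monomial_at \<alpha> \<zeta>) =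
        (\<Sum>j\<in>UNIV. c (e (Some j)) * \<zeta> $ Some j)"
      by (subst sum.reindex[OF e_inj]) (simp add: e_def monomial_at_single)
    finally show ?thesis by (simp add: monomial_at_def)
  qed
  then show ?thesis using q ideal by (intro that[of _ "c 0" "\<lambda>j. c (e (Some j))"]) auto
qed

text \<open>Now \<open>s\<close> is fixed and \<open>t\<close> varies, giving test curves into 0 on
  which |w| = t^2 while z has order at most t.\<close>

lemma filterlim_parabola:
  assumes "norm u \<le> 1" "cmod s < 1"
  shows "filterlim (\<lambda>t. parabola u t s) (at 0 within siegel) (at_right 0)"
proof -
  have ev: "\<forall>\<^sub>F t in at_right 0. t \<in> {0<..<1 :: real}"
    by (rule eventually_at_right_real) simp
  have "((\<lambda>t. parabola u t s) \<longlongrightarrow> 0) (at_right 0)"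
  proof (rule Lim_null_comparison)
    show "\<forall>\<^sub>F t in at_right 0. norm (parabola u t s) \<le> 2 * t"
      using ev by eventually_elim (use norm_parabola_less[OF assms] in \<open>simp add: less_imp_le\<close>)
    have "((\<lambda>t :: real. 2 * t) \<longlongrightarrow> 2 * 0) (at_right 0)" by (intro tendsto_intros)
    then show "((\<lambda>t :: real. 2 * t) \<longlongrightarrow> 0) (at_right 0)" by simp
  qed
  moreover have "\<forall>\<^sub>F t in at_right 0. parabola u t s \<in> siegel \<and> parabola u t s \<noteq> 0"
    using ev
  proof eventually_elim
    case (elim t)
    then show ?case
      using parabola_in_siegel[OF assms, of t] siegel_coordinate_le(2)[of "parabola u t s"] by force
  qed
  ultimately show ?thesis by (simp add: filterlim_at)
qed

text \<open>On the curve z = (t/2) e_j, w = i t^2 the affine function becomes d0 + d_j t/2. Being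
  O(t^2), it has vanishing constant and linear coefficients.\<close>

lemma affine_bigo_w_imp_0:
  fixes d :: "'n::finite \<Rightarrow> complex"
  assumes "(\<lambda>\<zeta>. d0 + (\<Sum>j\<in>UNIV. d j * \<zeta> $ Some j)) \<in> O[at 0 within siegel](\<lambda>\<zeta>. \<zeta> $ None)"
  shows "d0 = 0" "d j = 0"
proof -
  \<comment> \<open>Each test curve needs a direction \<open>j\<close>, so \<open>d0\<close> is
    treated together with \<open>d j\<close>; index types are nonempty, so some \<open>j\<close>
    exists.\<close>
  have *: "d0 = 0 \<and> d j = 0" for j
  proof -
    have "norm (axis j 1 :: complex ^ 'n) \<le> 1" by simp
    then have lim: "filterlim (\<lambda>t. parabola (axis j 1) t (1/2)) (at 0 within siegel) (at_right 0)"
      by (rule filterlim_parabola) simp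
    have "(\<Sum>k\<in>UNIV. d k * parabola (axis j 1) t (1/2) $ Some k) = d j * of_real t / 2" for t
    proof -
      have "(\<Sum>k\<in>UNIV. d k * parabola (axis j 1) t (1/2) $ Some k) =
          (\<Sum>k\<in>UNIV. if k = j then d j * of_real t / 2 else 0)"
        by (rule sum.cong) (auto simp: parabola_def axis_def)
      then show ?thesis by simp
    qed
    with landau_o.big.compose[OF assms lim]
    have "(\<lambda>t. d0 + d j * of_real t / 2) \<in> O[at_right 0](\<lambda>t. parabola (axis j 1) t (1/2) $ None)"
      by simp
    then have "(\<lambda>t. d0 + d j * of_real t / 2) \<in> O[at_right 0](\<lambda>t. \<i> * of_real (t\<^sup>2))"
      by (simp add: parabola_def)
    then obtain c where c: "\<forall>\<^sub>F t in at_right 0. cmod (d0 + d j * of_real t / 2) \<le> c * t\<^sup>2"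
      by (elim landau_o.bigE) (simp add: norm_mult norm_power)
    have "((\<lambda>t :: real. c * t\<^sup>2) \<longlongrightarrow> c * 0\<^sup>2) (at_right 0)" by (intro tendsto_intros)
    then have "((\<lambda>t. d0 + d j * of_real t / 2) \<longlongrightarrow> 0) (at_right 0)"
      using Lim_null_comparison[OF c] by simp
    moreover have "((\<lambda>t. d0 + d j * of_real t / 2) \<longlongrightarrow> d0 + d j * of_real 0 / 2) (at_right 0)"
      by (intro tendsto_intros) auto
    ultimately have d0: "d0 = 0"
      using tendsto_unique[of "at_right (0::real)"] by fastforce
    have ev: "\<forall>\<^sub>F t in at_right 0. cmod (d j) \<le> 2 * c * t"
      using c eventually_at_right_less[of 0]
    proof eventually_elim
      case (elim t)
      then have "cmod (d j) * t \<le> (2 * c * t) * t"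
        by (simp add: d0 norm_mult norm_divide power2_eq_square field_simps)
      then show ?case using elim by (simp add: mult_le_cancel_right)
    qed
    have "((\<lambda>t :: real. 2 * c * t) \<longlongrightarrow> 2 * c * 0) (at_right 0)" by (intro tendsto_intros)
    then have "cmod (d j) \<le> 2 * c * 0"
      by (rule tendsto_lowerbound[OF _ ev]) simp
    then show ?thesis using d0 by simp
  qed
  show "d0 = 0" "d j = 0" using * by blast+
qed

lemma quotient_bounded_iff_ideal:
  assumes p: "p \<in> \<Theta>[at 0 within siegel](\<lambda>\<zeta>. \<zeta> $ None)" and "analytic_near0 q"
  shows "bounded_near0 (\<lambda>\<zeta>. q \<zeta> / p \<zeta>) \<longleftrightarrow> q \<in> w_z_squared_ideal"
proof -
  have nz: "\<forall>\<^sub>F \<zeta> in at 0 within siegel. p \<zeta> \<noteq> 0"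
    using eventually_nonzero_bigtheta[OF p] eventually_siegel_None_nonzero by simp
  have "bounded_near0 (\<lambda>\<zeta>. q \<zeta> / p \<zeta>) \<longleftrightarrow> q \<in> O[at 0 within siegel](\<lambda>\<zeta>. 1 * p \<zeta>)"
    unfolding bounded_near0_iff_bigo by (rule landau_o.big.divide_eq2[OF nz])
  also have "\<dots> \<longleftrightarrow> q \<in> O[at 0 within siegel](\<lambda>\<zeta>. \<zeta> $ None)"
    using landau_o.big.cong_bigtheta[OF p] by simp
  also have "\<dots> \<longleftrightarrow> q \<in> w_z_squared_ideal"
  proof
    assume q_bigo: "q \<in> O[at 0 within siegel](\<lambda>\<zeta>. \<zeta> $ None)"
    obtain d0 d m where m: "m \<in> w_z_squared_ideal"
      and q: "\<forall>\<^sub>F \<zeta> in nhds 0. q \<zeta> = d0 + (\<Sum>j\<in>UNIV. d j * \<zeta> $ Some j) + m \<zeta>"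
      using analytic_near0_decomposition[OF assms(2)] by blast
    have "(\<lambda>\<zeta>. q \<zeta> - m \<zeta>) \<in> O[at 0 within siegel](\<lambda>\<zeta>. \<zeta> $ None)"
      using q_bigo w_z_squared_ideal_bigo[OF m] by (rule sum_in_bigo)
    moreover have "\<forall>\<^sub>F \<zeta> in nhds 0. q \<zeta> - m \<zeta> = d0 + (\<Sum>j\<in>UNIV. d j * \<zeta> $ Some j)"
      using q by eventually_elim simp
    then have "\<forall>\<^sub>F \<zeta> in at 0 within siegel. q \<zeta> - m \<zeta> = d0 + (\<Sum>j\<in>UNIV. d j * \<zeta> $ Some j)"
      by (rule filter_leD[OF at_within_le_nhds])
    ultimately have "(\<lambda>\<zeta>. d0 + (\<Sum>j\<in>UNIV. d j * \<zeta> $ Some j)) \<in> O[at 0 within siegel](\<lambda>\<zeta>. \<zeta> $ None)"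
      by (simp add: landau_o.big.in_cong)
    then have "d0 = 0" "\<And>j. d j = 0" by (rule affine_bigo_w_imp_0)+
    with q have qm: "\<forall>\<^sub>F \<zeta> in nhds 0. q \<zeta> = m \<zeta>" by simp
    \<comment> \<open>Only equality of \<open>q\<close> and \<open>m\<close> near 0 is known. Ideal
      membership is a condition on values near 0, so a representation of \<open>m\<close> also
      represents \<open>q\<close>.\<close>
    obtain T a where T: "finite T" "T \<subseteq> insert (\<lambda>\<zeta>. \<zeta> $ None) z_squared_ideal" "\<forall>g\<in>T. analytic_near0 (a g)"
      and "\<forall>\<^sub>F \<zeta> in nhds 0. m \<zeta> = (\<Sum>g\<in>T. a g \<zeta> * g \<zeta>)"
      using m unfolding w_z_squared_ideal_def generated_ideal_def by blast
    with qm have "\<forall>\<^sub>F \<zeta> in nhds 0. q \<zeta> = (\<Sum>g\<in>T. a g \<zeta> * g \<zeta>)"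
      by (auto elim: eventually_elim2)
    with T show "q \<in> w_z_squared_ideal"
      unfolding w_z_squared_ideal_def generated_ideal_def by blast
  qed (rule w_z_squared_ideal_bigo)
  finally show ?thesis .
qed

theorem theorem1p2:
  fixes p :: "('n::finite option \<Rightarrow>\<^sub>0 nat) \<Rightarrow>\<^sub>0 complex"
  shows
    "(nonvanishing_near0 (poly_at p) \<and> poly_at p 0 = 0 \<and> gradient0 (poly_at p) \<noteq> 0 \<longrightarrow>
        (\<exists>c. gradient0 (poly_at p) = c *s axis None 1) \<and>
        contractive ((1 / (2 * norm (gradient0 (poly_at p)))) *\<^sub>R hessian0 (poly_at p)))
     \<and>
     (poly_at p 0 = 0 \<and> (\<exists>c. c \<noteq> 0 \<and> gradient0 (poly_at p) = c *s axis None 1) \<and>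
      strictly_contractive ((1 / (2 * norm (gradient0 (poly_at p)))) *\<^sub>R hessian0 (poly_at p)) \<longrightarrow>
        nonvanishing_near0 (poly_at p) \<and>
        (\<forall>q. analytic_near0 q \<longrightarrow>
           (bounded_near0 (\<lambda>\<zeta>. q \<zeta> / poly_at p \<zeta>) \<longleftrightarrow> q \<in> w_z_squared_ideal)))"
proof (intro conjI impI; elim conjE exE)
  assume "nonvanishing_near0 (poly_at p)" "poly_at p 0 = 0" "gradient0 (poly_at p) \<noteq> 0"
  note a = nonvanishing_imp_gradient_contractive[OF this]
  show "\<exists>c. gradient0 (poly_at p) = c *s axis None 1" using a(1) by blast
  show "contractive ((1 / (2 * norm (gradient0 (poly_at p)))) *\<^sub>R hessian0 (poly_at p))"
    by (rule a(2))
next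
  fix c
  assume "poly_at p 0 = 0" "c \<noteq> 0" "gradient0 (poly_at p) = c *s axis None 1"
    "strictly_contractive ((1 / (2 * norm (gradient0 (poly_at p)))) *\<^sub>R hessian0 (poly_at p))"
  note \<Theta> = poly_at_bigtheta[OF this]
  show "nonvanishing_near0 (poly_at p)"
    unfolding nonvanishing_near0_iff
    using eventually_nonzero_bigtheta[OF \<Theta>] eventually_siegel_None_nonzero by simp
  show "\<forall>q. analytic_near0 q \<longrightarrow>
      (bounded_near0 (\<lambda>\<zeta>. q \<zeta> / poly_at p \<zeta>) \<longleftrightarrow> q \<in> w_z_squared_ideal)"
    using quotient_bounded_iff_ideal[OF \<Theta>] by blast
qed

end
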